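(* Let $\mathbf{T}=(T_1,\dots,T_d)$ be a commuting $d$-tuple of bounded operators on $\mathcal{H}$. For $t\in[0,1]$ and every $n\ge 1$, $r(\mathbf{T})\le\|\Delta_t^{(n+1)}(\mathbf{T})\|_2\le\|\Delta_t^{(n)}(\mathbf{T})\|_2\le\|\mathbf{T}\|_2$.
   Context: $\mathcal{H}$ is a complex infinite-dimensional Hilbert space. For a commuting $d$-tuple $\mathbf{T}=(T_1,\dots,T_d)$ of bounded operators on $\mathcal{H}$, put $P:=\sqrt{T_1^*T_1+\cdots+T_d^*T_d}$ and $\|\mathbf{T}\|_2:=\|P\|$. Let $T_i=V_iP$ $(i=1,\dots,d)$ be the canonical (spherical) polar decomposition: the column $(V_1,\dots,V_d)^{\mathsf T}:\mathcal{H}\to\mathcal{H}\oplus\cdots\oplus\mathcal{H}$ is the partial isometry in the polar decomposition of the column operator $(T_1,\dots,T_d)^{\mathsf T}$, so that $\bigcap_i\ker T_i=\bigcap_i\ker V_i=\ker P$. For $0\le t\le 1$ the generalized spherical Aluthge transform is $\Delta_t(\mathbf{T}):=(P^tV_1P^{1-t},\dots,P^tV_dP^{1-t})$, with the convention $P^0=I$; it is again a commuting $d$-tuple. $\Delta_t^{(n)}$ denotes the $n$-th iterate of $\Delta_t$. The Koszul complex $K(\mathbf{T},\mathcal{H})$ is the cochain complex $0\to\mathcal{H}\otimes\Lambda^0\to\cdots\to\mathcal{H}\otimes\Lambda^d\to 0$, where $\Lambda^k$ is the $k$-th exterior power of $\mathbb{C}^d$ with basis vectors $e_1,\dots,e_d$,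 with boundary maps $x\otimes\xi\mapsto\sum_{i=1}^d T_ix\otimes(e_i\wedge\xi)$. The Taylor spectrum $\sigma_T(\mathbf{T})$ is the set of $\boldsymbol{\lambda}\in\mathbb{C}^d$ such that the Koszul complex of $(T_1-\lambda_1,\dots,T_d-\lambda_d)$ is not exact. The joint spectral radius is $r(\mathbf{T}):=\sup\{\sqrt{|\lambda_1|^2+\cdots+|\lambda_d|^2}:(\lambda_1,\dots,\lambda_d)\in\sigma_T(\mathbf{T})\}$. *)

theory Defs
  imports "HOL-Analysis.Analysis" "HOL-Computational_Algebra.Polynomial"
begin

section \<open>Complex Hilbert spaces and operators\<close>

text \<open>The inner product is antilinear in its first argument. The last axiom says that
  the norm of the underlying Banach space is the Hilbert space norm; it also yields
  positive definiteness.\<close>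

class chilbert_space = banach +
  fixes scaleC :: "complex \<Rightarrow> 'a \<Rightarrow> 'a" (infixr "*\<^sub>C" 75)
    and cinner :: "'a \<Rightarrow> 'a \<Rightarrow> complex"
  assumes scaleC_add_right: "a *\<^sub>C (x + y) = a *\<^sub>C x + a *\<^sub>C y"
    and scaleC_add_left: "(a + b) *\<^sub>C x = a *\<^sub>C x + b *\<^sub>C x"
    and scaleC_scaleC: "a *\<^sub>C b *\<^sub>C x = (a * b) *\<^sub>C x"
    and scaleC_of_real: "complex_of_real r *\<^sub>C x = r *\<^sub>R x"
    and cinner_commute: "cinner x y = cnj (cinner y x)"
    and cinner_add_right: "cinner x (y + z) = cinner x y + cinner x z"
    and cinner_scaleC_right: "cinner x (a *\<^sub>C y) = a * cinner x y"
    and cinner_self: "cinner x x = complex_of_real ((norm x)\<^sup>2)"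

global_interpretation complex_vector:
  vector_space "scaleC :: complex \<Rightarrow> 'a \<Rightarrow> 'a::chilbert_space"
  defines cspan = complex_vector.span
proof unfold_locales
  show "1 *\<^sub>C x = x" for x :: 'a
    using scaleC_of_real[of 1 x] by simp
qed (simp_all add: scaleC_add_right scaleC_add_left scaleC_scaleC)

text \<open>The library type \<open>'a \<Rightarrow>\<^sub>L 'a\<close> consists of the bounded real-linear maps with the operator
  norm; bounded operators on a complex Hilbert space are the complex-linear ones among them.\<close>

definition complex_linear :: "('a::chilbert_space \<Rightarrow>\<^sub>L 'a) \<Rightarrow> bool" where
  "complex_linear A \<longleftrightarrow> (\<forall>c x. A (c *\<^sub>C x) = c *\<^sub>C A x)"

definition cadjoint :: "('a::chilbert_space \<Rightarrow>\<^sub>L 'a) \<Rightarrow> 'a \<Rightarrow>\<^sub>L 'a" where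
  "cadjoint A = (THE B :: 'a \<Rightarrow>\<^sub>L 'a. \<forall>x y. cinner (A x) y = cinner x (B y))"

definition positive_op :: "('a::chilbert_space \<Rightarrow>\<^sub>L 'a) \<Rightarrow> bool" where
  "positive_op A \<longleftrightarrow> complex_linear A \<and> (\<forall>x. cinner x (A x) \<in> \<real>\<^sub>\<ge>\<^sub>0)"

definition sqrt_op :: "('a::chilbert_space \<Rightarrow>\<^sub>L 'a) \<Rightarrow> 'a \<Rightarrow>\<^sub>L 'a" where
  "sqrt_op A = (THE B :: 'a \<Rightarrow>\<^sub>L 'a. positive_op B \<and> B o\<^sub>L B = A)"

text \<open>Continuous functional calculus of a positive operator \<open>A\<close>, whose spectrum lies in
  \<open>[0, \<parallel>A\<parallel>]\<close>: \<open>f(A)\<close> is the norm limit of \<open>p\<^sub>n(A)\<close> for real polynomials \<open>p\<^sub>n\<close> converging to \<open>f\<close>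
  uniformly on that interval.\<close>

definition poly_op :: "real poly \<Rightarrow> ('a::chilbert_space \<Rightarrow>\<^sub>L 'a) \<Rightarrow> 'a \<Rightarrow>\<^sub>L 'a" where
  "poly_op p A = (\<Sum>k\<le>degree p. coeff p k *\<^sub>R ((\<lambda>B. A o\<^sub>L B) ^^ k) id_blinfun)"

definition fun_calc :: "(real \<Rightarrow> real) \<Rightarrow> ('a::chilbert_space \<Rightarrow>\<^sub>L 'a) \<Rightarrow> 'a \<Rightarrow>\<^sub>L 'a" where
  "fun_calc f A = (THE B :: 'a \<Rightarrow>\<^sub>L 'a. \<forall>p :: nat \<Rightarrow> real poly.
     uniform_limit {0..norm A} (\<lambda>n. poly (p n)) f sequentially \<longrightarrow>
     (\<lambda>n. poly_op (p n) A) \<longlonglongrightarrow> B)"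

text \<open>The case \<open>t = 0\<close> is separate because \<open>0 powr 0 = 0\<close>, whereas \<open>A\<^sup>0 = I\<close>.\<close>

definition powr_op :: "('a::chilbert_space \<Rightarrow>\<^sub>L 'a) \<Rightarrow> real \<Rightarrow> 'a \<Rightarrow>\<^sub>L 'a" where
  "powr_op A t = (if t = 0 then id_blinfun else fun_calc (\<lambda>x. x powr t) A)"


section \<open>The spherical Aluthge transform\<close>

text \<open>A \<open>d\<close>-tuple is a family indexed by a finite type \<open>'d\<close> with \<open>d\<close> elements. The space
  \<open>'a ^ 'd\<close> carries the \<open>\<ell>\<^sup>2\<close> norm, so it is the Hilbert direct sum of \<open>d\<close> copies of \<open>'a\<close>.\<close>

definition spherical_modulus :: "('d::finite \<Rightarrow> 'a::chilbert_space \<Rightarrow>\<^sub>L 'a) \<Rightarrow> 'a \<Rightarrow>\<^sub>L 'a" where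
  "spherical_modulus T = sqrt_op (\<Sum>i\<in>UNIV. cadjoint (T i) o\<^sub>L T i)"

definition norm2 :: "('d::finite \<Rightarrow> 'a::chilbert_space \<Rightarrow>\<^sub>L 'a) \<Rightarrow> real" where
  "norm2 T = norm (spherical_modulus T)"

definition column :: "('d::finite \<Rightarrow> 'a::chilbert_space \<Rightarrow>\<^sub>L 'a) \<Rightarrow> 'a \<Rightarrow> 'a ^ 'd" where
  "column V x = (\<chi> i. V i x)"

definition column_partial_isometry :: "('d::finite \<Rightarrow> 'a::chilbert_space \<Rightarrow>\<^sub>L 'a) \<Rightarrow> bool" where
  "column_partial_isometry V \<longleftrightarrow>
     (\<forall>x. (\<forall>y. column V y = 0 \<longrightarrow> cinner y x = 0) \<longrightarrow> norm (column V x) = norm x)"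

definition spherical_polar ::
    "('d::finite \<Rightarrow> 'a::chilbert_space \<Rightarrow>\<^sub>L 'a) \<Rightarrow> 'd \<Rightarrow> 'a \<Rightarrow>\<^sub>L 'a" where
  "spherical_polar T = (THE V :: 'd \<Rightarrow> 'a \<Rightarrow>\<^sub>L 'a.
     (\<forall>i. complex_linear (V i)) \<and>
     (\<forall>i. T i = V i o\<^sub>L spherical_modulus T) \<and>
     column_partial_isometry V \<and>
     {x. column V x = 0} = {x. spherical_modulus T x = 0})"

definition aluthge ::
    "real \<Rightarrow> ('d::finite \<Rightarrow> 'a::chilbert_space \<Rightarrow>\<^sub>L 'a) \<Rightarrow> 'd \<Rightarrow> 'a \<Rightarrow>\<^sub>L 'a" where
  "aluthge t T = (\<lambda>i. powr_op (spherical_modulus T) t o\<^sub>L spherical_polar T i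
                        o\<^sub>L powr_op (spherical_modulus T) (1 - t))"


section \<open>Koszul complex and Taylor spectrum\<close>

text \<open>The exterior power \<open>\<Lambda>\<^sup>k\<close> has the basis \<open>e\<^sub>S = e\<^bsub>s\<^sub>1\<^esub> \<and> \<dots> \<and> e\<^bsub>s\<^sub>k\<^esub>\<close>, where
  \<open>S = {s\<^sub>1 < \<dots> < s\<^sub>k}\<close> ranges over the \<open>k\<close>-element sets of indices. The element
  \<open>\<Sum>\<^sub>S x\<^sub>S \<otimes> e\<^sub>S\<close> of \<open>H \<otimes> \<Lambda>\<^sup>k\<close> is represented by its coefficient function \<open>S \<mapsto> x\<^sub>S\<close>.\<close>

definition koszul_space :: "nat \<Rightarrow> ('d::{finite,linorder} set \<Rightarrow> 'a::chilbert_space) set" where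
  "koszul_space k = {\<omega>. \<forall>S. card S \<noteq> k \<longrightarrow> \<omega> S = 0}"

text \<open>The coefficient of \<open>e\<^sub>R\<close> in \<open>e\<^sub>i \<and> e\<^sub>S\<close>: moving \<open>e\<^sub>i\<close> to its place costs one transposition
  for each \<open>j \<in> S\<close> below \<open>i\<close>.\<close>

definition wedge_coeff :: "'d::{finite,linorder} \<Rightarrow> 'd set \<Rightarrow> 'd set \<Rightarrow> complex" where
  "wedge_coeff i S R =
     (if i \<notin> S \<and> R = insert i S then (- 1) ^ card {j \<in> S. j < i} else 0)"

definition koszul_map ::
    "('d::{finite,linorder} \<Rightarrow> 'a \<Rightarrow> 'a) \<Rightarrow> ('d set \<Rightarrow> 'a::chilbert_space) \<Rightarrow> 'd set \<Rightarrow> 'a" where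
  "koszul_map A \<omega> = (\<lambda>R. \<Sum>i\<in>UNIV. \<Sum>S\<in>UNIV. wedge_coeff i S R *\<^sub>C A i (\<omega> S))"

definition koszul_exact :: "('d::{finite,linorder} \<Rightarrow> 'a \<Rightarrow> 'a::chilbert_space) \<Rightarrow> bool" where
  "koszul_exact A \<longleftrightarrow>
     (\<forall>k. {\<omega> \<in> koszul_space k. koszul_map A \<omega> = (\<lambda>_. 0)} =
          (if k = 0 then {\<lambda>_. 0} else koszul_map A ` koszul_space (k - 1)))"

definition taylor_spectrum ::
    "('d::{finite,linorder} \<Rightarrow> 'a::chilbert_space \<Rightarrow>\<^sub>L 'a) \<Rightarrow> (complex, 'd) vec set" where
  "taylor_spectrum T = {l. \<not> koszul_exact (\<lambda>i x. T i x - (l $ i) *\<^sub>C x)}"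

text \<open>The norm of \<open>complex ^ 'd\<close> is the Euclidean one. The supremum is taken in the extended
  reals, where it needs no side conditions on the spectrum.\<close>

definition joint_spectral_radius ::
    "('d::{finite,linorder} \<Rightarrow> 'a::chilbert_space \<Rightarrow>\<^sub>L 'a) \<Rightarrow> ereal" where
  "joint_spectral_radius T = (SUP l\<in>taylor_spectrum T. ereal (norm l))"

end

theory Submission
  imports Defs "HOL-Computational_Algebra.Fundamental_Theorem_Algebra"
begin

text \<open>The norm does not increase because \<open>(V\<^sub>1, \<dots>, V\<^sub>d)\<close> is a column contraction and
  \<open>\<parallel>P\<^sup>t\<parallel> \<parallel>P\<^bsup>1-t\<^esup>\<parallel> \<le> \<parallel>P\<parallel>\<close>. For the spectral radius, the invariance of the Taylor spectrum under the
  transform is not needed. Given \<open>\<lambda>\<close>, put \<open>R = \<Sum>\<^sub>i cnj \<lambda>\<^sub>i T\<^sub>i\<close>. If \<open>\<parallel>\<lambda>\<parallel>\<^sup>2 - R\<close> is invertible, then its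
  inverse commutes with the tuple and yields a contracting homotopy of the Koszul complex of
  \<open>T - \<lambda>\<close>, as \<open>\<parallel>\<lambda>\<parallel>\<^sup>2 - R = - \<Sum>\<^sub>i cnj \<lambda>\<^sub>i (T\<^sub>i - \<lambda>\<^sub>i)\<close>. Now \<open>R = (V\<^sub>\<lambda> P\<^bsup>1-t\<^esup>) P\<^sup>t\<close> for
  \<open>V\<^sub>\<lambda> = \<Sum>\<^sub>i cnj \<lambda>\<^sub>i V\<^sub>i\<close>, and exchanging the two factors gives the operator \<open>R'\<close> of the transformed
  tuple; so \<open>R\<close> and \<open>R'\<close> have the same nonzero spectrum. Hence invertibility may be checked after
  any number of transforms, where \<open>\<parallel>R'\<parallel> \<le> \<parallel>\<lambda>\<parallel> \<parallel>\<Delta>\<^sub>t\<^bsup>(n)\<^esup>(T)\<parallel>\<^sub>2 < \<parallel>\<lambda>\<parallel>\<^sup>2\<close> settles it.\<close>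

section \<open>The inner product\<close>

lemma scaleC_minus_one: "(- 1) *\<^sub>C x = - (x::'a::chilbert_space)"
  using scaleC_of_real[of "-1" x] by simp

lemma scaleC_scaleR: "c *\<^sub>C (r *\<^sub>R x) = r *\<^sub>R (c *\<^sub>C (x::'a::chilbert_space))"
  by (metis scaleC_of_real scaleC_scaleC mult.commute)

lemma cinner_zero_right [simp]: "cinner x (0::'a::chilbert_space) = 0"
  using cinner_add_right[of x 0 0] by simp

lemma cinner_minus_right: "cinner x (- y) = - cinner x (y::'a::chilbert_space)"
  using cinner_scaleC_right[of x "-1" y] by (simp add: scaleC_minus_one)

lemma cinner_diff_right: "cinner x (y - z) = cinner x y - cinner x (z::'a::chilbert_space)"
  using cinner_add_right[of x y "-z"] by (simp add: cinner_minus_right)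

lemma cinner_scaleR_right: "cinner x (r *\<^sub>R y) = of_real r * cinner x (y::'a::chilbert_space)"
  by (metis cinner_scaleC_right scaleC_of_real)

lemma cinner_zero_left [simp]: "cinner (0::'a::chilbert_space) y = 0"
  by (metis cinner_commute cinner_zero_right complex_cnj_zero)

lemma cinner_add_left: "cinner (x + y) z = cinner x z + cinner y (z::'a::chilbert_space)"
  by (metis cinner_add_right cinner_commute complex_cnj_add)

lemma cinner_diff_left: "cinner (x - y) z = cinner x z - cinner y (z::'a::chilbert_space)"
  by (metis cinner_diff_right cinner_commute complex_cnj_diff)

lemma cinner_scaleC_left: "cinner (a *\<^sub>C x) y = cnj a * cinner x (y::'a::chilbert_space)"
  by (metis cinner_scaleC_right cinner_commute complex_cnj_mult)

lemma cinner_scaleR_left: "cinner (r *\<^sub>R x) y = of_real r * cinner x (y::'a::chilbert_space)"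
  by (metis cinner_scaleC_left scaleC_of_real complex_cnj_complex_of_real)

lemma cinner_sum_right: "cinner x (\<Sum>i\<in>A. f i) = (\<Sum>i\<in>A. cinner x (f i :: 'a::chilbert_space))"
  by (induction A rule: infinite_finite_induct) (simp_all add: cinner_add_right)

lemma Re_cinner_commute: "Re (cinner x y) = Re (cinner y (x::'a::chilbert_space))"
  by (subst cinner_commute) simp

lemma power2_norm_eq_cinner: "(norm x)\<^sup>2 = Re (cinner x (x::'a::chilbert_space))"
  by (simp add: cinner_self)

lemma power2_norm_diff:
  "(norm (x - y))\<^sup>2 = (norm x)\<^sup>2 - 2 * Re (cinner x y) + (norm (y::'a::chilbert_space))\<^sup>2"
  by (simp add: power2_norm_eq_cinner cinner_diff_left cinner_diff_right Re_cinner_commute[of y x])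

lemma power2_norm_add:
  "(norm (x + y))\<^sup>2 = (norm x)\<^sup>2 + 2 * Re (cinner x y) + (norm (y::'a::chilbert_space))\<^sup>2"
  by (simp add: power2_norm_eq_cinner cinner_add_left cinner_add_right Re_cinner_commute[of y x])

lemma norm_scaleC: "norm (c *\<^sub>C x) = cmod c * norm (x::'a::chilbert_space)"
proof -
  have "complex_of_real ((norm (c *\<^sub>C x))\<^sup>2) = cnj c * c * complex_of_real ((norm x)\<^sup>2)"
    by (simp only: cinner_self[symmetric] cinner_scaleC_right cinner_scaleC_left mult_ac)
  also have "\<dots> = complex_of_real ((cmod c * norm x)\<^sup>2)"
    using complex_norm_square[of c] by (simp add: power_mult_distrib mult_ac)
  finally have "(norm (c *\<^sub>C x))\<^sup>2 = (cmod c * norm x)\<^sup>2"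
    using of_real_eq_iff by blast
  then show ?thesis
    by (simp add: power2_eq_iff_nonneg)
qed

text \<open>Cauchy-Schwarz, read off from the squared norm of
  \<open>n *\<^sub>R x - c *\<^sub>C y\<close>: the multiple of \<open>y\<close> removes the
  component of \<open>x\<close> along \<open>y\<close>, and scaling \<open>x\<close> by
  \<open>n = (norm y)\<^sup>2\<close> avoids a division.\<close>

lemma norm_cinner_le: "cmod (cinner x y) \<le> norm x * norm (y::'a::chilbert_space)"
proof (cases "y = 0")
  case False
  define c where "c = cinner y x"
  define n where "n = (norm y)\<^sup>2"
  have n: "n > 0" using False by (simp add: n_def)
  have "Re (cinner x (c *\<^sub>C y)) = (cmod c)\<^sup>2"
    by (subst cinner_commute)
      (simp add: cinner_scaleC_left c_def complex_norm_square[symmetric] cmod_power2 power2_eq_square)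
  then have "(norm (n *\<^sub>R x - c *\<^sub>C y))\<^sup>2 = n\<^sup>2 * (norm x)\<^sup>2 - 2 * (n * (cmod c)\<^sup>2) + (cmod c)\<^sup>2 * n"
    by (simp add: power2_norm_diff cinner_scaleR_left norm_scaleC power_mult_distrib n_def)
  also have "\<dots> = n * (n * (norm x)\<^sup>2 - (cmod c)\<^sup>2)"
    by (simp add: algebra_simps power2_eq_square)
  finally have "(norm (n *\<^sub>R x - c *\<^sub>C y))\<^sup>2 = n * (n * (norm x)\<^sup>2 - (cmod c)\<^sup>2)" .
  then have "0 \<le> n * (n * (norm x)\<^sup>2 - (cmod c)\<^sup>2)"
    by (metis zero_le_power2)
  then have "(cmod c)\<^sup>2 \<le> (norm x * norm y)\<^sup>2"
    using n by (simp add: zero_le_mult_iff n_def power_mult_distrib mult.commute)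
  then have "cmod c \<le> norm x * norm y"
    by (simp add: power2_le_iff_abs_le)
  then show ?thesis
    by (metis c_def cinner_commute complex_mod_cnj)
qed simp

lemma bounded_bilinear_cinner: "bounded_bilinear (cinner :: 'a::chilbert_space \<Rightarrow> 'a \<Rightarrow> complex)"
proof (rule bounded_bilinear.intro)
  show "\<exists>K. \<forall>a b::'a. norm (cinner a b) \<le> norm a * norm b * K"
    by (intro exI[of _ 1]) (simp add: norm_cinner_le)
qed (simp_all add: cinner_add_left cinner_add_right cinner_scaleR_left cinner_scaleR_right
    scaleR_conv_of_real)

lemmas tendsto_cinner [tendsto_intros] = bounded_bilinear.tendsto[OF bounded_bilinear_cinner]

lemma bounded_linear_scaleC: "bounded_linear (\<lambda>x::'a::chilbert_space. c *\<^sub>C x)"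
  by (rule bounded_linear_intro[of _ "cmod c"])
    (simp_all add: scaleC_add_right scaleC_scaleR norm_scaleC mult.commute)

lemmas tendsto_scaleC [tendsto_intros] = bounded_linear.tendsto[OF bounded_linear_scaleC]

lemma scaleC_simps:
  fixes x y :: "'a::chilbert_space"
  shows "c *\<^sub>C (x - y) = c *\<^sub>C x - c *\<^sub>C y" "c *\<^sub>C 0 = (0::'a)" "c *\<^sub>C (- x) = - (c *\<^sub>C x)"
    "0 *\<^sub>C x = 0" "1 *\<^sub>C x = x" "(- c) *\<^sub>C x = - (c *\<^sub>C x)" "(c - d) *\<^sub>C x = c *\<^sub>C x - d *\<^sub>C x"
  by (simp_all add: complex_vector.scale_right_diff_distrib complex_vector.scale_left_diff_distrib)

lemma scaleC_sum_right: "c *\<^sub>C (\<Sum>i\<in>A. f i) = (\<Sum>i\<in>A. c *\<^sub>C (f i :: 'a::chilbert_space))"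
  by (rule complex_vector.scale_sum_right)

lemma cinner_extensionality:
  fixes x y :: "'a::chilbert_space"
  assumes "\<And>z. cinner z x = cinner z y"
  shows "x = y"
proof -
  have "cinner (x - y) (x - y) = 0"
    by (simp add: cinner_diff_right assms)
  then show ?thesis
    by (simp add: cinner_self)
qed

section \<open>Adjoints and positive operators\<close>

text \<open>The representing vector minimises \<open>\<parallel>z\<parallel>\<^sup>2 - 2 f(z)\<close>; minimising sequences are Cauchy by
  the parallelogram law.\<close>

lemma riesz_representation:
  fixes f :: "'a::chilbert_space \<Rightarrow> real"
  assumes f: "bounded_linear f"
  shows "\<exists>z. \<forall>x. f x = Re (cinner z x)"
proof -
  interpret f: bounded_linear f by fact
  define J where "J z = (norm z)\<^sup>2 - 2 * f z" for z
  define m where "m = Inf (range J)"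
  obtain K where K: "\<And>x. norm (f x) \<le> norm x * K" and "K \<ge> 0"
    using f.nonneg_bounded by blast
  \<comment> \<open>Completing the square in \<open>norm z\<close> bounds \<open>J\<close> below by
    \<open>- K\<^sup>2\<close>, so the infimum \<open>m\<close> is finite.\<close>
  have "- K\<^sup>2 \<le> J z" for z
  proof -
    have "f z \<le> norm z * K" using K[of z] by simp
    moreover have "0 \<le> (norm z - K)\<^sup>2" by simp
    ultimately show ?thesis by (simp add: J_def power2_diff)
  qed
  then have bdd: "bdd_below (range J)" by (intro bdd_belowI2)
  have mJ: "m \<le> J z" for z
    unfolding m_def by (rule cInf_lower[OF _ bdd]) simp
  have "\<exists>z. J z < m + inverse (Suc n)" for n
  proof -
    have "Inf (range J) < m + inverse (Suc n)" by (simp add: m_def)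
    from cInf_lessD[OF _ this] show ?thesis by auto
  qed
  then obtain Z where Z: "\<And>n. J (Z n) < m + inverse (Suc n)" by metis
  have par: "(norm (z - w))\<^sup>2 \<le> 2 * (J z - m) + 2 * (J w - m)" for z w
  proof -
    have "4 * J ((1/2) *\<^sub>R (z + w)) = 2 * J z + 2 * J w - (norm (z - w))\<^sup>2"
      by (simp add: J_def f.scaleR f.add power_divide power2_norm_add power2_norm_diff add_divide_distrib)
    with mJ[of "(1/2) *\<^sub>R (z + w)"] show ?thesis by simp
  qed
  have "Cauchy Z"
  proof (rule metric_CauchyI)
    fix e :: real assume "e > 0"
    then obtain N where N: "inverse (Suc N) < e\<^sup>2 / 4"
      using reals_Archimedean[of "e\<^sup>2 / 4"] by auto
    have lt: "J (Z n) - m < e\<^sup>2 / 4" if "n \<ge> N" for n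
    proof -
      have "inverse (real (Suc n)) \<le> inverse (Suc N)" using that by (simp add: field_simps)
      with Z[of n] N show ?thesis by linarith
    qed
    have "dist (Z a) (Z b) < e" if "a \<ge> N" "b \<ge> N" for a b
    proof -
      have "(norm (Z a - Z b))\<^sup>2 < e\<^sup>2"
        using par[of "Z a" "Z b"] lt[OF that(1)] lt[OF that(2)] by argo
      then show ?thesis
        using \<open>e > 0\<close> by (simp add: dist_norm power2_less_imp_less)
    qed
    then show "\<exists>M. \<forall>a\<ge>M. \<forall>b\<ge>M. dist (Z a) (Z b) < e" by blast
  qed
  then obtain z where z: "Z \<longlonglongrightarrow> z" using Cauchy_convergent convergent_def by blast
  have "(\<lambda>n. J (Z n)) \<longlonglongrightarrow> J z"
    unfolding J_def by (intro tendsto_intros z f.tendsto)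
  moreover have "(\<lambda>n. m + inverse (Suc n)) \<longlonglongrightarrow> m + 0"
    by (intro tendsto_intros LIMSEQ_inverse_real_of_nat)
  ultimately have "J z \<le> m + 0"
    by (rule LIMSEQ_le) (intro exI[of _ 0] allI impI less_imp_le Z)
  then have Jz: "J z \<le> J w" for w using mJ[of w] by simp
  have "f x = Re (cinner z x)" for x
  proof -
    define c where "c = Re (cinner z x) - f x"
    have quad: "0 \<le> s\<^sup>2 * (norm x)\<^sup>2 + 2 * s * c" for s
    proof -
      have "J (z + s *\<^sub>R x) = J z + (s\<^sup>2 * (norm x)\<^sup>2 + 2 * s * c)"
        by (simp add: J_def power2_norm_add cinner_scaleR_right f.add f.scaleR c_def
            power_mult_distrib right_diff_distrib)
      with Jz[of "z + s *\<^sub>R x"] show ?thesis by linarith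
    qed
    \<comment> \<open>The quadratic in \<open>s\<close> is evaluated at \<open>s = - c / D\<close>,
      where it would be negative unless \<open>c = 0\<close>; the summand 1 in \<open>D\<close>
      keeps the quotient defined for \<open>x = 0\<close>.\<close>
    define D where "D = 1 + (norm x)\<^sup>2"
    have D: "D > 0" by (simp add: D_def add_pos_nonneg)
    define k where "k = c / D"
    have c: "c = k * D" using D by (simp add: k_def)
    have "0 \<le> (- k)\<^sup>2 * (norm x)\<^sup>2 + 2 * (- k) * c" by (rule quad)
    also have "\<dots> = k\<^sup>2 * ((norm x)\<^sup>2 - 2 * D)"
      by (simp add: c power2_eq_square right_diff_distrib)
    finally have "0 \<le> k\<^sup>2 * ((norm x)\<^sup>2 - 2 * D)" .
    moreover have "(norm x)\<^sup>2 - 2 * D < 0"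
      using zero_le_power2[of "norm x"] unfolding D_def by argo
    ultimately have "k\<^sup>2 \<le> 0"
      by (meson mult_pos_neg not_le)
    then have "c = 0" by (simp add: c)
    then show ?thesis by (simp add: c_def)
  qed
  then show ?thesis by blast
qed

text \<open>The Riesz theorem above is real, so it is applied to the real part of
  \<open>cinner y (A x)\<close>; the complex identity is recovered afterwards.\<close>

lemma adjoint_exists:
  fixes A :: "'a::chilbert_space \<Rightarrow>\<^sub>L 'a"
  assumes A: "complex_linear A"
  shows "\<exists>B::'a \<Rightarrow>\<^sub>L 'a. \<forall>x y. cinner (A x) y = cinner x (B y)"
proof -
  have "\<exists>z. \<forall>x. Re (cinner y (A x)) = Re (cinner z x)" for y
    by (rule riesz_representation)
      (intro bounded_linear_compose[OF bounded_linear_Re]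
        bounded_linear_compose[OF bounded_bilinear.bounded_linear_right[OF bounded_bilinear_cinner]]
        blinfun.bounded_linear_right)
  then obtain B where B: "\<And>x y. Re (cinner y (A x)) = Re (cinner (B y) x)" by metis
  have re: "Re (cinner (A x) y) = Re (cinner x (B y))" for x y
    by (metis B Re_cinner_commute)
  \<comment> \<open>Replacing \<open>x\<close> by \<open>\<i> *\<^sub>C x\<close> turns real parts
    into imaginary parts; this is where complex linearity of \<open>A\<close> enters.\<close>
  have full: "cinner (A x) y = cinner x (B y)" for x y
  proof (rule complex_eqI[OF re])
    have "Re (cinner (A (\<i> *\<^sub>C x)) y) = Re (cinner (\<i> *\<^sub>C x) (B y))" by (rule re)
    then show "Im (cinner (A x) y) = Im (cinner x (B y))"
      using A by (simp add: complex_linear_def cinner_scaleC_left)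
  qed
  have "bounded_linear B"
  proof (rule bounded_linear_intro)
    show "B (x + y) = B x + B y" for x y
      by (rule cinner_extensionality) (simp add: full[symmetric] cinner_add_right)
    show "B (r *\<^sub>R x) = r *\<^sub>R B x" for r x
      by (rule cinner_extensionality) (simp add: full[symmetric] cinner_scaleR_right)
    show "norm (B y) \<le> norm y * norm A" for y
    proof -
      have "(norm (B y))\<^sup>2 = cmod (cinner (A (B y)) y)"
        by (simp add: full cinner_self norm_power)
      also have "\<dots> \<le> norm (A (B y)) * norm y" by (rule norm_cinner_le)
      also have "\<dots> \<le> norm A * norm (B y) * norm y"
        by (intro mult_right_mono norm_blinfun norm_ge_zero)
      finally have "norm (B y) * norm (B y) \<le> norm (B y) * (norm y * norm A)"
        by (simp add: power2_eq_square mult_ac)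
      then show ?thesis
        by (metis mult_le_cancel_left norm_ge_zero norm_zero mult_nonneg_nonneg not_less_iff_gr_or_eq
            linorder_not_less)
    qed
  qed
  then have "\<forall>x y. cinner (A x) y = cinner x (Blinfun B y)"
    by (simp add: full bounded_linear_Blinfun_apply)
  then show ?thesis by blast
qed

lemma cadjoint:
  assumes "complex_linear A"
  shows "cinner (A x) y = cinner x (cadjoint A y)"
proof -
  have "\<exists>!B::'a \<Rightarrow>\<^sub>L 'a. \<forall>x y. cinner (A x) y = cinner x (B y)"
    using adjoint_exists[OF assms]
    by (metis blinfun_eqI cinner_extensionality)
  from theI'[OF this] show ?thesis
    unfolding cadjoint_def by blast
qed

lemma complex_linear_cadjoint:
  assumes "complex_linear A"
  shows "complex_linear (cadjoint A)"
  unfolding complex_linear_def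
  by (intro allI cinner_extensionality)
    (simp add: cadjoint[OF assms, symmetric] cinner_scaleC_right)

lemma complex_linear_id: "complex_linear id_blinfun"
  by (simp add: complex_linear_def)

lemma complex_linear_compose:
  "complex_linear A \<Longrightarrow> complex_linear B \<Longrightarrow> complex_linear (A o\<^sub>L B)"
  by (simp add: complex_linear_def)

lemma complex_linear_sum:
  "(\<And>i. i \<in> I \<Longrightarrow> complex_linear (A i)) \<Longrightarrow> complex_linear (\<Sum>i\<in>I. A i)"
  by (simp add: complex_linear_def blinfun.sum_left scaleC_sum_right)

lemma complex_linear_lim:
  assumes "\<And>n. complex_linear (A n)" and lim: "A \<longlonglongrightarrow> B"
  shows "complex_linear B"
  unfolding complex_linear_def
proof (intro allI)
  fix c x
  have "(\<lambda>n. A n (c *\<^sub>C x)) \<longlonglongrightarrow> B (c *\<^sub>C x)" by (intro tendsto_intros lim)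
  moreover have "(\<lambda>n. c *\<^sub>C A n x) \<longlonglongrightarrow> c *\<^sub>C B x" by (intro tendsto_intros lim)
  ultimately show "B (c *\<^sub>C x) = c *\<^sub>C B x"
    using assms(1) by (simp add: complex_linear_def LIMSEQ_unique)
qed

section \<open>Selfadjoint operators and their relation to positive ones\<close>

definition selfadjoint :: "('a::chilbert_space \<Rightarrow>\<^sub>L 'a) \<Rightarrow> bool" where
  "selfadjoint A \<longleftrightarrow> (\<forall>x y. cinner (A x) y = cinner x (A y))"

text \<open>Polarisation: the quadratic form is real at \<open>x + y\<close> and at
  \<open>x + \<i> *\<^sub>C y\<close>, which determines the imaginary and the real part of the
  difference between \<open>cinner x (A y)\<close> and the conjugate of
  \<open>cinner y (A x)\<close>.\<close>

lemma positive_op_selfadjoint: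
  assumes "positive_op A"
  shows "selfadjoint A"
proof -
  have lin: "A (c *\<^sub>C x) = c *\<^sub>C A x" for c x
    using assms by (simp add: positive_op_def complex_linear_def)
  have real: "Im (cinner x (A x)) = 0" for x
    using assms by (auto simp: positive_op_def complex_nonneg_Reals_iff)
  have "cinner x (A y) = cnj (cinner y (A x))" for x y
  proof -
    have "Im (cinner x (A y)) + Im (cinner y (A x)) = 0"
      using real[of "x + y"] real[of x] real[of y]
      by (simp add: blinfun.add_right cinner_add_left cinner_add_right)
    moreover have "Re (cinner x (A y)) - Re (cinner y (A x)) = 0"
      using real[of "x + \<i> *\<^sub>C y"] real[of x] real[of y]
      by (simp add: blinfun.add_right cinner_add_left cinner_add_right lin cinner_scaleC_left
          cinner_scaleC_right)
    ultimately show ?thesis by (simp add: complex_eq_iff)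
  qed
  then show ?thesis
    unfolding selfadjoint_def by (metis cinner_commute)
qed

lemma positive_op_Re: "positive_op A \<Longrightarrow> 0 \<le> Re (cinner x (A x))"
  by (simp add: positive_op_def complex_nonneg_Reals_iff)

lemma selfadjoint_positive_op:
  assumes "complex_linear A" "selfadjoint A" "\<And>x. 0 \<le> Re (cinner x (A x))"
  shows "positive_op A"
proof -
  have "Im (cinner x (A x)) = 0" for x
    by (metis assms(2) selfadjoint_def cinner_commute complex_cnj_cancel_iff
        Reals_cnj_iff complex_is_Real_iff)
  then show ?thesis
    using assms by (simp add: positive_op_def complex_nonneg_Reals_iff)
qed

lemma selfadjoint_norm_square:
  assumes "selfadjoint A"
  shows "(norm (A x))\<^sup>2 = Re (cinner x ((A o\<^sub>L A) x))"
  using assms by (simp add: selfadjoint_def power2_norm_eq_cinner)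

lemma selfadjoint_lim:
  assumes "\<And>n. selfadjoint (A n)" and lim: "A \<longlonglongrightarrow> B"
  shows "selfadjoint B"
  unfolding selfadjoint_def
proof (intro allI)
  fix x y
  have "(\<lambda>n. cinner (A n x) y) \<longlonglongrightarrow> cinner (B x) y" by (intro tendsto_intros lim)
  moreover have "(\<lambda>n. cinner x (A n y)) \<longlonglongrightarrow> cinner x (B y)" by (intro tendsto_intros lim)
  ultimately show "cinner (B x) y = cinner x (B y)"
    using assms(1) by (simp add: selfadjoint_def LIMSEQ_unique)
qed

section \<open>Polynomials in a positive operator\<close>

lemma poly_op_eq_sum:
  assumes "degree p \<le> n"
  shows "poly_op p A = (\<Sum>k\<le>n. coeff p k *\<^sub>R ((\<lambda>B. A o\<^sub>L B) ^^ k) id_blinfun)"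
  unfolding poly_op_def
  by (rule sum.mono_neutral_left) (use assms in \<open>auto simp: coeff_eq_0\<close>)

lemma poly_op_0 [simp]: "poly_op 0 A = 0"
  by (simp add: poly_op_def)

lemma poly_op_add: "poly_op (p + q) A = poly_op p A + poly_op q A"
  using degree_add_le_max[of p q]
  by (simp add: poly_op_eq_sum[of _ "max (degree p) (degree q)"] sum.distrib scaleR_left_distrib)

lemma poly_op_smult: "poly_op (smult c p) A = c *\<^sub>R poly_op p A"
  using degree_smult_le[of c p]
  by (simp add: poly_op_eq_sum[of _ "degree p"] scaleR_sum_right)

lemma poly_op_diff: "poly_op (p - q) A = poly_op p A - poly_op q A"
  using poly_op_add[of "p - q" q A] by (simp add: algebra_simps)

lemma poly_op_pCons: "poly_op (pCons a p) A = a *\<^sub>R id_blinfun + (A o\<^sub>L poly_op p A)"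
proof (rule blinfun_eqI)
  fix x
  have "poly_op (pCons a p) A
      = (\<Sum>k\<le>Suc (degree p). coeff (pCons a p) k *\<^sub>R ((\<lambda>B. A o\<^sub>L B) ^^ k) id_blinfun)"
    by (rule poly_op_eq_sum) (rule degree_pCons_le)
  then show "poly_op (pCons a p) A x = (a *\<^sub>R id_blinfun + (A o\<^sub>L poly_op p A)) x"
    by (simp add: sum.atMost_Suc_shift poly_op_def blinfun.add_left blinfun.sum_left
        blinfun.sum_right blinfun.scaleR_left blinfun.scaleR_right del: sum.atMost_Suc)
qed

lemma poly_op_mult: "poly_op (p * q) A = poly_op p A o\<^sub>L poly_op q A"
proof (induction p)
  case (pCons a p)
  show ?case
    by (rule blinfun_eqI)
      (simp add: poly_op_add poly_op_smult poly_op_pCons pCons.IH blinfun.add_left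
        blinfun.scaleR_left blinfun.zero_left)
qed (simp add: blinfun_compose_zero)

lemma poly_op_X: "poly_op [:0, 1:] A = A"
  by (rule blinfun_eqI) (simp add: poly_op_pCons blinfun.add_left blinfun.scaleR_left)

lemma poly_op_const: "poly_op [:c:] A = c *\<^sub>R id_blinfun"
  by (rule blinfun_eqI) (simp add: poly_op_pCons blinfun.add_left blinfun.scaleR_left)

text \<open>Prepares the uniqueness of square roots, where polynomials in
  \<open>B o\<^sub>L B\<close> must be read as polynomials in \<open>B\<close>.\<close>

lemma poly_op_pcompose_square:
  "poly_op (pcompose p [:0, 0, 1:]) A = poly_op p (A o\<^sub>L A)"
proof (induction p)
  case (pCons a p)
  have "poly_op [:0, 0, 1:] A = A o\<^sub>L A"
    by (rule blinfun_eqI) (simp add: poly_op_pCons blinfun.add_left blinfun.scaleR_left blinfun.zero_left)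
  with pCons.IH show ?case
    by (simp only: pcompose_pCons poly_op_add poly_op_mult poly_op_const poly_op_pCons[of a p])
qed simp

lemma complex_linear_poly_op:
  assumes "complex_linear A"
  shows "complex_linear (poly_op p A)"
proof (induction p)
  case (pCons a p)
  with assms show ?case
    by (simp add: poly_op_pCons complex_linear_def blinfun.add_left blinfun.scaleR_left
        scaleC_add_right scaleC_scaleR)
qed (simp add: complex_linear_def scaleC_simps)

lemma poly_op_commute: "A (poly_op p A x) = poly_op p A (A x)"
proof -
  have "poly_op [:0, 1:] A o\<^sub>L poly_op p A = poly_op p A o\<^sub>L poly_op [:0, 1:] A"
    by (simp only: poly_op_mult[symmetric] mult.commute)
  then have "A o\<^sub>L poly_op p A = poly_op p A o\<^sub>L A"
    by (simp only: poly_op_X)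
  then show ?thesis
    by (metis blinfun_apply_blinfun_compose)
qed

lemma selfadjoint_poly_op:
  assumes "selfadjoint A"
  shows "selfadjoint (poly_op p A)"
proof (induction p)
  case (pCons a p)
  have "A (poly_op p A x) = poly_op p A (A x)" for x
    by (rule poly_op_commute)
  then show ?case
    using assms pCons.IH
    by (simp add: selfadjoint_def poly_op_pCons blinfun.add_left blinfun.scaleR_left
        cinner_add_left cinner_add_right cinner_scaleR_left cinner_scaleR_right)
qed (simp add: selfadjoint_def)

section \<open>Polynomials positive on an interval, and positivity of their operator values\<close>

text \<open>Every polynomial positive on \<open>[0, M]\<close> lies in this cone, and a positive operator of norm
  at most \<open>M\<close> maps the cone to positive operators.\<close>

inductive_set interval_cone :: "real \<Rightarrow> real poly set" for M where
  base: "g \<in> {1, [:0, 1:], [:M, -1:], [:0, 1:] * [:M, -1:]} \<Longrightarrow> q * (g * q) \<in> interval_cone M"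
| add: "p \<in> interval_cone M \<Longrightarrow> q \<in> interval_cone M \<Longrightarrow> p + q \<in> interval_cone M"

lemma interval_cone_square_mult:
  "p \<in> interval_cone M \<Longrightarrow> s * s * p \<in> interval_cone M"
proof (induction rule: interval_cone.induct)
  case (base g q)
  then have "(s * q) * (g * (s * q)) \<in> interval_cone M" by (rule interval_cone.base)
  then show ?case by (simp only: mult_ac)
qed (simp add: distrib_left interval_cone.add)

lemma interval_cone_scale:
  assumes "p \<in> interval_cone M" "c \<ge> 0"
  shows "smult c p \<in> interval_cone M"
  using interval_cone_square_mult[OF assms(1), of "[:sqrt c:]"] assms(2) by simp

text \<open>Multiplication by \<open>X\<close> exchanges the generators 1 and \<open>X\<close>, and
  likewise \<open>M - X\<close> and \<open>X * (M - X)\<close>; a resulting square of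
  \<open>X\<close> is absorbed into the factor \<open>q\<close>. Multiplication by
  \<open>M - X\<close> below works in the same way.\<close>

lemma interval_cone_mult_lower:
  "p \<in> interval_cone M \<Longrightarrow> [:0, 1:] * p \<in> interval_cone M"
proof (induction rule: interval_cone.induct)
  case (base g q)
  let ?X = "[:0, 1:] :: real poly" and ?Y = "[:M, -1:]"
  consider "g = 1" | "g = ?X" | "g = ?Y" | "g = ?X * ?Y" using base by blast
  then show ?case
  proof cases
    case 1
    have "q * (?X * q) \<in> interval_cone M" by (rule interval_cone.base) blast
    then show ?thesis by (simp only: 1 mult_ac mult_1)
  next
    case 2
    have "(?X * q) * (1 * (?X * q)) \<in> interval_cone M" by (rule interval_cone.base) blast
    then show ?thesis by (simp only: 2 mult_ac mult_1)
  next
    case 3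
    have "q * ((?X * ?Y) * q) \<in> interval_cone M" by (rule interval_cone.base) blast
    then show ?thesis by (simp only: 3 mult_ac)
  next
    case 4
    have "(?X * q) * (?Y * (?X * q)) \<in> interval_cone M" by (rule interval_cone.base) blast
    then show ?thesis by (simp only: 4 mult_ac)
  qed
next
  case (add p q)
  then show ?case by (simp only: distrib_left interval_cone.add)
qed

lemma interval_cone_mult_upper:
  "p \<in> interval_cone M \<Longrightarrow> [:M, -1:] * p \<in> interval_cone M"
proof (induction rule: interval_cone.induct)
  case (base g q)
  let ?X = "[:0, 1:] :: real poly" and ?Y = "[:M, -1:]"
  consider "g = 1" | "g = ?X" | "g = ?Y" | "g = ?X * ?Y" using base by blast
  then show ?case
  proof cases
    case 1
    have "q * (?Y * q) \<in> interval_cone M" by (rule interval_cone.base) blast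
    then show ?thesis by (simp only: 1 mult_ac mult_1)
  next
    case 2
    have "q * ((?X * ?Y) * q) \<in> interval_cone M" by (rule interval_cone.base) blast
    then show ?thesis by (simp only: 2 mult_ac)
  next
    case 3
    have "(?Y * q) * (1 * (?Y * q)) \<in> interval_cone M" by (rule interval_cone.base) blast
    then show ?thesis by (simp only: 3 mult_ac mult_1)
  next
    case 4
    have "(?Y * q) * (?X * (?Y * q)) \<in> interval_cone M" by (rule interval_cone.base) blast
    then show ?thesis by (simp only: 4 mult_ac)
  qed
next
  case (add p q)
  then show ?case by (simp only: distrib_left interval_cone.add)
qed

lemma map_poly_of_real_add:
  "map_poly of_real (p + q) = map_poly of_real p + (map_poly of_real q :: complex poly)"
  by (rule poly_eqI) (simp add: coeff_map_poly)

lemma map_poly_of_real_mult: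
  "map_poly of_real (p * q) = map_poly of_real p * (map_poly of_real q :: complex poly)"
proof (induction p)
  case (pCons a p)
  have "map_poly of_real (smult a q) = smult (of_real a) (map_poly of_real q :: complex poly)"
    by (rule poly_eqI) (simp add: coeff_map_poly)
  with pCons.IH show ?case
    by (simp add: map_poly_of_real_add map_poly_pCons)
qed simp

lemma poly_map_poly_of_real:
  "poly (map_poly of_real p) (of_real r) = (of_real (poly p r) :: complex)"
  by (induction p) (simp_all add: map_poly_pCons)

text \<open>The divisor is the product of \<open>X - z\<close> and \<open>X - cnj z\<close>. The
  remainder is a real polynomial \<open>a + b X\<close> vanishing at the nonreal \<open>z\<close>,
  which forces \<open>b = 0\<close> and then \<open>a = 0\<close>.\<close>

lemma nonreal_root_quadratic_dvd:
  fixes p :: "real poly"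
  assumes root: "poly (map_poly of_real p) z = 0" and "Im z \<noteq> 0"
  shows "([:- Re z, 1:] * [:- Re z, 1:] + [:(Im z)\<^sup>2:]) dvd p"
proof -
  define m :: "real poly" where "m = [:- Re z, 1:] * [:- Re z, 1:] + [:(Im z)\<^sup>2:]"
  have deg: "degree m = 2" and m0: "m \<noteq> 0" by (simp_all add: m_def)
  have "poly (map_poly of_real m) z = 0"
    by (simp add: m_def map_poly_pCons complex_eq_iff power2_eq_square algebra_simps)
  moreover have "poly (map_poly of_real p) z
      = poly (map_poly of_real (p div m)) z * poly (map_poly of_real m) z
        + poly (map_poly of_real (p mod m)) z"
    by (metis div_mult_mod_eq map_poly_of_real_add map_poly_of_real_mult poly_add poly_mult)
  ultimately have s: "poly (map_poly of_real (p mod m)) z = 0" using root by simp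
  have "degree (p mod m) < 2"
    using degree_mod_less[OF m0, of p] deg by auto
  then have "p mod m = [:coeff (p mod m) 0, coeff (p mod m) 1:]"
    by (intro poly_eqI) (auto simp: coeff_pCons coeff_eq_0 split: nat.splits)
  then obtain a b where ab: "p mod m = [:a, b:]" by blast
  with s have "of_real a + z * of_real b = 0" by (simp add: map_poly_pCons)
  then have "b = 0" "a = 0" using \<open>Im z \<noteq> 0\<close> by (auto simp: complex_eq_iff)
  with ab show ?thesis by (simp add: m_def mod_eq_0_iff_dvd)
qed

text \<open>Induction on the degree, splitting off a complex root. A root \<open>r < 0\<close> gives
  the factor \<open>X + (- r)\<close>, a root \<open>r > M\<close> the factor
  \<open>(M - X) + (r - M)\<close>, and a nonreal root a square plus a positive constant;
  multiplication by each preserves the cone. Positivity excludes roots inside the interval.\<close>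

lemma positive_poly_in_interval_cone:
  assumes "\<And>x. x \<in> {0..M} \<Longrightarrow> poly p x > 0" and "M \<ge> 0"
  shows "p \<in> interval_cone M"
  using assms(1)
proof (induction "degree p" arbitrary: p rule: less_induct)
  case less
  show ?case
  proof (cases "degree p = 0")
    case True
    then obtain c where c: "p = [:c:]" by (rule degree_eq_zeroE)
    with less.prems[of 0] assms(2) have "c > 0" by simp
    moreover have "1 * (1 * 1) \<in> interval_cone M" by (rule interval_cone.base) blast
    ultimately have "smult c (1 * (1 * 1)) \<in> interval_cone M"
      by (intro interval_cone_scale) auto
    then show ?thesis by (simp add: c)
  next
    case False
    then have "\<not> constant (poly (map_poly complex_of_real p))"
      by (simp add: constant_degree degree_map_poly)
    then obtain z where z: "poly (map_poly complex_of_real p) z = 0"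
      using fundamental_theorem_of_algebra by blast
    show ?thesis
    proof (cases "Im z = 0")
      case True
      define r where "r = Re z"
      have "z = of_real r" using True by (simp add: r_def complex_eq_iff)
      with z have "poly p r = 0" by (simp add: poly_map_poly_of_real)
      then obtain q where q: "p = [:- r, 1:] * q"
        by (metis poly_eq_0_iff_dvd dvdE)
      have degq: "degree q < degree p"
        using False by (cases "q = 0") (simp_all add: q degree_mult_eq del: mult_pCons_left)
      have out: "r < 0 \<or> r > M"
        using less.prems[of r] \<open>poly p r = 0\<close> by force
      have px: "poly p x = (x - r) * poly q x" for x by (simp add: q algebra_simps)
      from out show ?thesis
      proof
        assume r: "r < 0"
        have "poly q x > 0" if "x \<in> {0..M}" for x
          using less.prems[OF that] that r by (simp add: px zero_less_mult_iff)
        then have q_cone: "q \<in> interval_cone M" using less.hyps[OF degq] by blast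
        have "[:0, 1:] * q + smult (- r) q \<in> interval_cone M"
          using r by (intro interval_cone.add interval_cone_mult_lower interval_cone_scale q_cone) auto
        then show ?thesis by (simp add: q add.commute)
      next
        \<comment> \<open>Now \<open>x - r\<close> is negative on the interval, so the cofactor that
          stays positive there is \<open>- q\<close>.\<close>
        assume r: "r > M"
        have "poly (- q) x > 0" if "x \<in> {0..M}" for x
          using less.prems[OF that] that r by (simp add: px zero_less_mult_iff)
        then have q_cone: "- q \<in> interval_cone M" using less.hyps[of "- q"] degq by simp
        have "[:M, -1:] * (- q) + smult (r - M) (- q) \<in> interval_cone M"
          using r by (intro interval_cone.add interval_cone_mult_upper interval_cone_scale q_cone) auto
        then show ?thesis by (simp add: q smult_diff_left algebra_simps)
      qed
    next
      case False
      let ?l = "[:- Re z, 1:]"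
      obtain q where q: "p = (?l * ?l + [:(Im z)\<^sup>2:]) * q"
        using nonreal_root_quadratic_dvd[OF z False] by (auto elim: dvdE)
      have px: "poly p x = ((x - Re z)\<^sup>2 + (Im z)\<^sup>2) * poly q x" for x
        by (simp add: q power2_eq_square algebra_simps)
      have "q \<noteq> 0" using \<open>degree p \<noteq> 0\<close> by (auto simp: q)
      moreover have "degree (?l * ?l + [:(Im z)\<^sup>2:]) = 2" "?l * ?l + [:(Im z)\<^sup>2:] \<noteq> 0" by simp_all
      ultimately have degq: "degree q < degree p"
        unfolding q by (subst degree_mult_eq) simp_all
      have "poly q x > 0" if "x \<in> {0..M}" for x
      proof -
        have "(x - Re z)\<^sup>2 + (Im z)\<^sup>2 > 0" using False by (simp add: add_nonneg_pos)
        then show ?thesis using less.prems[OF that] by (simp add: px zero_less_mult_iff)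
      qed
      then have q_cone: "q \<in> interval_cone M" using less.hyps[OF degq] by blast
      have "?l * ?l * q + smult ((Im z)\<^sup>2) q \<in> interval_cone M"
        by (intro interval_cone.add interval_cone_square_mult interval_cone_scale q_cone) simp
      then show ?thesis 
        by (simp only: q distrib_right mult_pCons_left[of "(Im z)\<^sup>2" 0] mult_zero_left pCons_0_0
            add_0_right)
    qed
  qed
qed

text \<open>Since \<open>poly_op q A\<close> is selfadjoint, the form of \<open>q * (g * q)\<close>
  at \<open>y\<close> is the form of \<open>g\<close> at \<open>poly_op q A y\<close>, so only the
  four generators have to be examined.\<close>

lemma interval_cone_op_nonneg:
  assumes A: "positive_op A" and p: "p \<in> interval_cone (norm A)"
  shows "0 \<le> Re (cinner y (poly_op p A y))"
  using p
proof (induction arbitrary: y)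
  case (base g q)
  define M where "M = norm A"
  have sa: "cinner (A x) y = cinner x (A y)" for x y
    using positive_op_selfadjoint[OF A] by (simp add: selfadjoint_def)
  have pos: "0 \<le> Re (cinner x (A x))" for x using A by (rule positive_op_Re)
  have up: "Re (cinner x (A x)) \<le> M * (norm x)\<^sup>2" for x
  proof -
    have "Re (cinner x (A x)) \<le> norm x * norm (A x)"
      using norm_cinner_le complex_Re_le_cmod order_trans by blast
    also have "\<dots> \<le> norm x * (M * norm x)"
      unfolding M_def by (intro mult_left_mono norm_blinfun norm_ge_zero)
    finally show ?thesis by (simp add: power2_eq_square mult_ac)
  qed
  have Y: "poly_op [:M, -1:] A x = M *\<^sub>R x - A x" for x
    by (simp add: poly_op_pCons blinfun.add_left blinfun.scaleR_left blinfun.scaleR_right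
        blinfun.zero_left blinfun.minus_left blinfun.minus_right)
  have g_pos: "0 \<le> Re (cinner x (poly_op g A x))" for x
  proof -
    consider "g = [:1:]" | "g = [:0, 1:]" | "g = [:M, -1:]" | "g = [:0, 1:] * [:M, -1:]"
      using base by (auto simp: M_def one_pCons)
    then show ?thesis
    proof cases
      case 1
      then show ?thesis
        by (simp add: poly_op_const power2_norm_eq_cinner[symmetric])
    next
      case 2
      then show ?thesis by (simp add: poly_op_X pos)
    next
      case 3
      then show ?thesis
        using up[of x]
        by (simp only: Y cinner_diff_right cinner_scaleR_right) (simp add: cinner_self)
    next
      case 4
      define u where "u = A x"
      have g: "Re (cinner x (poly_op g A x)) = M * Re (cinner x u) - (norm u)\<^sup>2"
        by (simp only: 4 poly_op_mult poly_op_X blinfun_apply_blinfun_compose Y)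
          (simp add: blinfun.diff_right blinfun.scaleR_right cinner_diff_right cinner_scaleR_right
            sa[symmetric] cinner_self u_def)
      show ?thesis
      proof (cases "M = 0")
        case True
        then have "u = 0" by (simp add: M_def u_def)
        then show ?thesis by (simp add: g)
      next
        case False
        then have "M > 0" by (simp add: M_def)
        \<comment> \<open>The identity \<open>M A (M - A) = (M - A) A (M - A) + A (M - A) A\<close>
          writes \<open>M\<close> times the wanted operator as a sum of two positive ones; the
          second is the form of \<open>M - A\<close> at \<open>u = A x\<close>.\<close>
        have "0 \<le> Re (cinner (M *\<^sub>R x - u) (A (M *\<^sub>R x - u))) + (M * (norm u)\<^sup>2 - Re (cinner u (A u)))"
          using pos[of "M *\<^sub>R x - u"] up[of u] by simp
        also have "Re (cinner (M *\<^sub>R x - u) (A (M *\<^sub>R x - u)))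
            = M * (M * Re (cinner x u)) - 2 * (M * (norm u)\<^sup>2) + Re (cinner u (A u))"
          by (simp add: blinfun.diff_right blinfun.scaleR_right cinner_diff_right cinner_diff_left
              cinner_scaleR_right cinner_scaleR_left sa[symmetric] u_def[symmetric] right_diff_distrib
              power2_norm_eq_cinner)
        finally have "0 \<le> M * (M * Re (cinner x u) - (norm u)\<^sup>2)" by (simp add: right_diff_distrib)
        with \<open>M > 0\<close> show ?thesis by (simp add: g zero_le_mult_iff)
      qed
    qed
  qed
  have "selfadjoint (poly_op q A)"
    by (intro selfadjoint_poly_op positive_op_selfadjoint A)
  with g_pos[of "poly_op q A y"] show ?case
    by (simp add: poly_op_mult selfadjoint_def)
next
  case (add p q)
  then show ?case by (simp add: poly_op_add blinfun.add_left cinner_add_right add_nonneg_nonneg)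
qed

text \<open>The cone result needs strict positivity, so a small constant is added to
  \<open>p\<close> and then removed in the limit.\<close>

lemma poly_op_nonneg:
  assumes A: "positive_op A" and p: "\<And>x. x \<in> {0..norm A} \<Longrightarrow> poly p x \<ge> 0"
  shows "0 \<le> Re (cinner y (poly_op p A y))"
proof (cases "y = 0")
  case False
  show ?thesis
  proof (rule field_le_epsilon)
    fix e :: real assume "e > 0"
    \<comment> \<open>With this \<open>c\<close> the added constant contributes exactly
      \<open>e\<close> to the quadratic form at \<open>y\<close>.\<close>
    define c where "c = e / (norm y)\<^sup>2"
    have "c > 0" using \<open>e > 0\<close> False by (simp add: c_def)
    then have "p + [:c:] \<in> interval_cone (norm A)"
      by (intro positive_poly_in_interval_cone) (use p in \<open>force intro: add_nonneg_pos\<close>)+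
    from interval_cone_op_nonneg[OF A this, of y]
    show "0 \<le> Re (cinner y (poly_op p A y)) + e"
      using False by (simp add: poly_op_add poly_op_const blinfun.add_left blinfun.scaleR_left
          cinner_add_right cinner_scaleR_right cinner_self c_def)
  qed
qed simp

text \<open>The polynomial \<open>c\<^sup>2 - p\<^sup>2\<close> is nonnegative on the interval, and
  the form of \<open>p\<^sup>2\<close> at \<open>y\<close> is the squared norm of
  \<open>poly_op p A y\<close>. This estimate carries the whole functional calculus: it turns
  uniform convergence on the interval into norm convergence of operators.\<close>

lemma norm_poly_op_le:
  assumes A: "positive_op A" and p: "\<And>x. x \<in> {0..norm A} \<Longrightarrow> \<bar>poly p x\<bar> \<le> c"
  shows "norm (poly_op p A) \<le> c"
proof (rule norm_blinfun_bound)
  show c: "0 \<le> c" using p[of 0] by simp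
  fix y
  have sa: "selfadjoint (poly_op p A)"
    by (intro selfadjoint_poly_op positive_op_selfadjoint A)
  have "0 \<le> Re (cinner y (poly_op ([:c\<^sup>2:] - p * p) A y))"
    using p by (intro poly_op_nonneg[OF A])
      (simp add: power2_eq_square[symmetric] abs_le_square_iff[symmetric] c)
  then have "(norm (poly_op p A y))\<^sup>2 \<le> (c * norm y)\<^sup>2"
    by (simp add: poly_op_diff poly_op_const poly_op_mult blinfun.diff_left blinfun.scaleR_left
        cinner_diff_right cinner_scaleR_right cinner_self selfadjoint_norm_square[OF sa]
        power_mult_distrib)
  then show "norm (poly_op p A y) \<le> c * norm y"
    by (rule power2_le_imp_le) (simp add: c)
qed

section \<open>Functional calculus, square roots and fractional powers\<close>

lemma uniform_limit_poly_exists: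
  fixes f :: "real \<Rightarrow> real"
  assumes "continuous_on {a..b} f"
  obtains p where "uniform_limit {a..b} (\<lambda>n. poly (p n)) f sequentially"
proof -
  obtain g where g: "uniform_limit {a..b} g f sequentially" "\<And>n. polynomial_function (g n)"
    using Stone_Weierstrass_uniform_limit[OF compact_Icc assms] by blast
  have "\<exists>p. g n = poly p" for n
  proof -
    obtain c N where "g n = (\<lambda>x. \<Sum>i\<le>N. c i * x ^ i)"
      using g(2)[of n] by (auto simp: real_polynomial_function_eq[symmetric]
          real_polynomial_function_iff_sum)
    then have "g n = poly (\<Sum>i\<le>N. monom (c i) i)"
      by (simp add: fun_eq_iff poly_sum poly_monom)
    then show ?thesis by blast
  qed
  then obtain p where "\<And>n. g n = poly (p n)" by metis
  then have "g = (\<lambda>n. poly (p n))" by blast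
  with g(1) that show thesis by simp
qed

lemma poly_op_convergent:
  assumes A: "positive_op A" and p: "uniform_limit {0..norm A} (\<lambda>n. poly (p n)) f sequentially"
  shows "convergent (\<lambda>n. poly_op (p n) A)"
proof -
  have "Cauchy (\<lambda>n. poly_op (p n) A)"
  proof (rule metric_CauchyI)
    fix e :: real assume "e > 0"
    then have "\<forall>\<^sub>F n in sequentially. \<forall>x\<in>{0..norm A}. dist (poly (p n) x) (f x) < e / 3"
      using uniform_limitD[OF p, of "e / 3"] by simp
    then obtain N where N: "\<And>n x. n \<ge> N \<Longrightarrow> x \<in> {0..norm A} \<Longrightarrow> \<bar>poly (p n) x - f x\<bar> < e / 3"
      unfolding eventually_sequentially dist_real_def by blast
    have "dist (poly_op (p m) A) (poly_op (p n) A) < e" if mn: "m \<ge> N" "n \<ge> N" for m n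
    proof -
      have "norm (poly_op (p m - p n) A) \<le> 2 * (e / 3)"
      proof (rule norm_poly_op_le[OF A])
        fix x assume "x \<in> {0..norm A}"
        with N[OF mn(1) this] N[OF mn(2) this] show "\<bar>poly (p m - p n) x\<bar> \<le> 2 * (e / 3)"
          unfolding poly_diff by argo
      qed
      with \<open>e > 0\<close> show ?thesis by (simp add: dist_norm poly_op_diff)
    qed
    then show "\<exists>M. \<forall>m\<ge>M. \<forall>n\<ge>M. dist (poly_op (p m) A) (poly_op (p n) A) < e" by blast
  qed
  then show ?thesis by (rule Cauchy_convergent)
qed

text \<open>The two sequences are interleaved into one that still converges uniformly to
  \<open>f\<close>; its operator limit is then attained along both the even and the odd
  indices.\<close>

lemma poly_op_limit_unique:
  assumes A: "positive_op A"
    and p: "uniform_limit {0..norm A} (\<lambda>n. poly (p n)) f sequentially" "(\<lambda>n. poly_op (p n) A) \<longlonglongrightarrow> B"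
    and q: "uniform_limit {0..norm A} (\<lambda>n. poly (q n)) f sequentially" "(\<lambda>n. poly_op (q n) A) \<longlonglongrightarrow> C"
  shows "B = C"
proof -
  define r where "r n = (if even n then p (n div 2) else q (n div 2))" for n
  have "uniform_limit {0..norm A} (\<lambda>n. poly (r n)) f sequentially"
  proof (rule uniform_limitI)
    fix e :: real assume e: "e > 0"
    obtain M where M: "\<And>n. n \<ge> M \<Longrightarrow> \<forall>x\<in>{0..norm A}. dist (poly (p n) x) (f x) < e"
      using uniform_limitD[OF p(1) e] by (auto simp: eventually_sequentially)
    obtain N where N: "\<And>n. n \<ge> N \<Longrightarrow> \<forall>x\<in>{0..norm A}. dist (poly (q n) x) (f x) < e"
      using uniform_limitD[OF q(1) e] by (auto simp: eventually_sequentially)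
    show "\<forall>\<^sub>F n in sequentially. \<forall>x\<in>{0..norm A}. dist (poly (r n) x) (f x) < e"
      unfolding eventually_sequentially
    proof (intro exI[of _ "2 * (M + N)"] allI impI)
      fix n assume "2 * (M + N) \<le> n"
      then have "n div 2 \<ge> M + N" by presburger
      then show "\<forall>x\<in>{0..norm A}. dist (poly (r n) x) (f x) < e"
        using M N by (simp add: r_def)
    qed
  qed
  from poly_op_convergent[OF A this] obtain L where L: "(\<lambda>n. poly_op (r n) A) \<longlonglongrightarrow> L"
    by (auto simp: convergent_def)
  have "(\<lambda>n. poly_op (r (2 * n)) A) \<longlonglongrightarrow> L"
    using LIMSEQ_subseq_LIMSEQ[OF L, of "\<lambda>n. 2 * n"] by (simp add: strict_mono_def o_def)
  moreover have "(\<lambda>n. poly_op (r (2 * n + 1)) A) \<longlonglongrightarrow> L"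
    using LIMSEQ_subseq_LIMSEQ[OF L, of "\<lambda>n. 2 * n + 1"] by (simp add: strict_mono_def o_def)
  ultimately have "B = L" "C = L"
    using p(2) q(2) by (auto simp: r_def intro: LIMSEQ_unique)
  then show ?thesis by simp
qed

text \<open>Justifies the definite description in \<open>fun_calc\<close>: all approximating
  sequences share one limit, and the given sequence \<open>p\<close> ensures that there is at least
  one, so the limit is determined.\<close>

lemma fun_calc_tendsto:
  assumes A: "positive_op A" and p: "uniform_limit {0..norm A} (\<lambda>n. poly (p n)) f sequentially"
  shows "(\<lambda>n. poly_op (p n) A) \<longlonglongrightarrow> fun_calc f A"
proof -
  obtain B where B: "(\<lambda>n. poly_op (p n) A) \<longlonglongrightarrow> B"
    using poly_op_convergent[OF A p] by (auto simp: convergent_def)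
  have lim: "(\<lambda>n. poly_op (q n) A) \<longlonglongrightarrow> B"
    if q: "uniform_limit {0..norm A} (\<lambda>n. poly (q n)) f sequentially" for q
  proof -
    obtain C where C: "(\<lambda>n. poly_op (q n) A) \<longlonglongrightarrow> C"
      using poly_op_convergent[OF A q] by (auto simp: convergent_def)
    with poly_op_limit_unique[OF A p B q C] show ?thesis by simp
  qed
  have "fun_calc f A = B"
    unfolding fun_calc_def
  proof (rule the_equality)
    show "\<forall>p. uniform_limit {0..norm A} (\<lambda>n. poly (p n)) f sequentially \<longrightarrow>
        (\<lambda>n. poly_op (p n) A) \<longlonglongrightarrow> B"
      using lim by blast
    fix C
    assume "\<forall>p. uniform_limit {0..norm A} (\<lambda>n. poly (p n)) f sequentially \<longrightarrow>
        (\<lambda>n. poly_op (p n) A) \<longlonglongrightarrow> C"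
    with p have "(\<lambda>n. poly_op (p n) A) \<longlonglongrightarrow> C" by blast
    with B show "C = B" using LIMSEQ_unique by blast
  qed
  with B show ?thesis by simp
qed

lemma complex_linear_fun_calc:
  assumes A: "positive_op A" and f: "continuous_on {0..norm A} f"
  shows "complex_linear (fun_calc f A)"
proof -
  obtain p where p: "uniform_limit {0..norm A} (\<lambda>n. poly (p n)) f sequentially"
    using uniform_limit_poly_exists[OF f] .
  from fun_calc_tendsto[OF A p] show ?thesis
    by (rule complex_linear_lim[rotated])
      (use A in \<open>simp add: complex_linear_poly_op positive_op_def\<close>)
qed

lemma selfadjoint_fun_calc:
  assumes A: "positive_op A" and f: "continuous_on {0..norm A} f"
  shows "selfadjoint (fun_calc f A)"
proof -
  obtain p where p: "uniform_limit {0..norm A} (\<lambda>n. poly (p n)) f sequentially"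
    using uniform_limit_poly_exists[OF f] .
  from fun_calc_tendsto[OF A p] show ?thesis
    by (rule selfadjoint_lim[rotated]) (intro selfadjoint_poly_op positive_op_selfadjoint A)
qed

lemma fun_calc_mult:
  assumes A: "positive_op A" and f: "continuous_on {0..norm A} f" and g: "continuous_on {0..norm A} g"
  shows "fun_calc f A o\<^sub>L fun_calc g A = fun_calc (\<lambda>x. f x * g x) A"
proof -
  obtain p where p: "uniform_limit {0..norm A} (\<lambda>n. poly (p n)) f sequentially"
    using uniform_limit_poly_exists[OF f] .
  obtain q where q: "uniform_limit {0..norm A} (\<lambda>n. poly (q n)) g sequentially"
    using uniform_limit_poly_exists[OF g] .
  have "bounded (f ` {0..norm A})" "bounded (g ` {0..norm A})"
    using f g by (simp_all add: compact_continuous_image compact_imp_bounded)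
  from uniform_lim_mult[OF p q this]
  have "uniform_limit {0..norm A} (\<lambda>n. poly (p n * q n)) (\<lambda>x. f x * g x) sequentially"
    by (simp add: poly_mult[abs_def])
  from fun_calc_tendsto[OF A this]
  have "(\<lambda>n. poly_op (p n) A o\<^sub>L poly_op (q n) A) \<longlonglongrightarrow> fun_calc (\<lambda>x. f x * g x) A"
    by (simp add: poly_op_mult)
  moreover have "(\<lambda>n. poly_op (p n) A o\<^sub>L poly_op (q n) A) \<longlonglongrightarrow> (fun_calc f A o\<^sub>L fun_calc g A)"
    by (intro tendsto_intros fun_calc_tendsto A p q)
  ultimately show ?thesis using LIMSEQ_unique by blast
qed

text \<open>The constant sequence \<open>[:0, 1:]\<close> is an admissible approximation. Agreement
  is asked only on the interval, so that functions such as \<open>sqrt x * sqrt x\<close>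
  qualify.\<close>

lemma fun_calc_id:
  assumes A: "positive_op A" and f: "\<And>x. x \<in> {0..norm A} \<Longrightarrow> f x = x"
  shows "fun_calc f A = A"
proof -
  have "uniform_limit {0..norm A} (\<lambda>n. poly [:0, 1:]) f sequentially"
    using f by (intro uniform_limitI) simp
  from fun_calc_tendsto[OF A this] have "(\<lambda>n. A) \<longlonglongrightarrow> fun_calc f A"
    by (simp add: poly_op_X)
  then show ?thesis by (simp add: LIMSEQ_const_iff)
qed

lemma norm_fun_calc_le:
  assumes A: "positive_op A" and f: "continuous_on {0..norm A} f"
    and c: "\<And>x. x \<in> {0..norm A} \<Longrightarrow> \<bar>f x\<bar> \<le> c"
  shows "norm (fun_calc f A) \<le> c"
proof (rule field_le_epsilon)
  fix e :: real assume "e > 0"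
  obtain p where p: "uniform_limit {0..norm A} (\<lambda>n. poly (p n)) f sequentially"
    using uniform_limit_poly_exists[OF f] .
  have "\<forall>\<^sub>F n in sequentially. norm (poly_op (p n) A) \<le> c + e"
    using uniform_limitD[OF p \<open>e > 0\<close>]
  proof (rule eventually_mono)
    fix n assume n: "\<forall>x\<in>{0..norm A}. dist (poly (p n) x) (f x) < e"
    show "norm (poly_op (p n) A) \<le> c + e"
    proof (rule norm_poly_op_le[OF A])
      fix x assume x: "x \<in> {0..norm A}"
      from n x c[OF x] show "\<bar>poly (p n) x\<bar> \<le> c + e"
        by (force simp: dist_real_def)
    qed
  qed
  then show "norm (fun_calc f A) \<le> c + e"
    using tendsto_upperbound[OF tendsto_norm[OF fun_calc_tendsto[OF A p]]] by simp
qed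

section \<open>Uniqueness and existence of positive square roots\<close>

text \<open>Uniqueness: if \<open>p\<^sub>n(x) \<longlonglongrightarrow> \<surd>x\<close> uniformly, then \<open>p\<^sub>n(x\<^sup>2) \<longlonglongrightarrow> x\<close> uniformly, so
  \<open>B\<^sup>2 = A\<close> forces \<open>B = lim p\<^sub>n(B\<^sup>2) = lim p\<^sub>n(A)\<close>.\<close>

lemma positive_sqrt_unique:
  assumes B: "positive_op B" and A: "positive_op (B o\<^sub>L B)"
  shows "B = fun_calc sqrt (B o\<^sub>L B)"
proof -
  \<comment> \<open>Squaring must map \<open>{0..norm B}\<close> into the interval on which the
    \<open>p n\<close> approximate \<open>sqrt\<close>. This amounts to
    \<open>(norm B)\<^sup>2 \<le> norm (B o\<^sub>L B)\<close>, which holds because \<open>B\<close>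
    is selfadjoint.\<close>
  have le: "x\<^sup>2 \<le> norm (B o\<^sub>L B)" if "x \<in> {0..norm B}" for x
  proof -
    have "norm B \<le> sqrt (norm (B o\<^sub>L B))"
    proof (rule norm_blinfun_bound)
      fix y
      have "(norm (B y))\<^sup>2 = Re (cinner y ((B o\<^sub>L B) y))"
        by (intro selfadjoint_norm_square positive_op_selfadjoint B)
      also have "\<dots> \<le> norm y * norm ((B o\<^sub>L B) y)"
        using norm_cinner_le complex_Re_le_cmod order_trans by blast
      also have "\<dots> \<le> norm y * (norm (B o\<^sub>L B) * norm y)"
        by (intro mult_left_mono norm_blinfun norm_ge_zero)
      also have "\<dots> = (sqrt (norm (B o\<^sub>L B)) * norm y)\<^sup>2"
        by (simp add: power_mult_distrib power2_eq_square mult_ac)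
      finally show "norm (B y) \<le> sqrt (norm (B o\<^sub>L B)) * norm y"
        by (rule power2_le_imp_le) simp
    qed simp
    with that have "x \<le> sqrt (norm (B o\<^sub>L B))" by simp
    from power_mono[OF this, of 2] that show ?thesis by simp
  qed
  obtain p where p: "uniform_limit {0..norm (B o\<^sub>L B)} (\<lambda>n. poly (p n)) sqrt sequentially"
    using uniform_limit_poly_exists[OF continuous_on_real_sqrt[OF continuous_on_id]] by blast
  have "uniform_limit {0..norm B} (\<lambda>n x. poly (p n) (x\<^sup>2)) (\<lambda>x. sqrt (x\<^sup>2)) sequentially"
    by (rule uniform_limit_compose'[OF p]) (use le in auto)
  moreover have "poly (pcompose (p n) [:0, 0, 1:]) = (\<lambda>x. poly (p n) (x\<^sup>2))" for n
    by (simp add: fun_eq_iff poly_pcompose power2_eq_square)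
  ultimately have "uniform_limit {0..norm B} (\<lambda>n. poly (pcompose (p n) [:0, 0, 1:])) (\<lambda>x. sqrt (x\<^sup>2)) sequentially"
    by simp
  from fun_calc_tendsto[OF B this]
  have "(\<lambda>n. poly_op (p n) (B o\<^sub>L B)) \<longlonglongrightarrow> fun_calc (\<lambda>x. sqrt (x\<^sup>2)) B"
    by (simp only: poly_op_pcompose_square)
  moreover have "fun_calc (\<lambda>x. sqrt (x\<^sup>2)) B = B"
    by (rule fun_calc_id[OF B]) simp
  ultimately show ?thesis
    using fun_calc_tendsto[OF A p] LIMSEQ_unique by fastforce
qed

text \<open>The root \<open>?R\<close> is positive because it is the square of the selfadjoint
  fourth root \<open>?Q\<close>: its form at \<open>x\<close> is the squared norm of
  \<open>?Q x\<close>.\<close>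

lemma sqrt_op:
  assumes A: "positive_op A"
  shows "positive_op (sqrt_op A)" "sqrt_op A o\<^sub>L sqrt_op A = A"
proof -
  let ?R = "fun_calc sqrt A" and ?Q = "fun_calc (\<lambda>x. sqrt (sqrt x)) A"
  have cont: "continuous_on {0..norm A} sqrt" "continuous_on {0..norm A} (\<lambda>x. sqrt (sqrt x))"
    by (intro continuous_intros)+
  have RR: "?R o\<^sub>L ?R = A"
    unfolding fun_calc_mult[OF A cont(1) cont(1)] by (rule fun_calc_id[OF A]) simp
  have QQ: "?Q o\<^sub>L ?Q = ?R"
  proof -
    have "?Q o\<^sub>L ?Q = fun_calc (\<lambda>x. sqrt (sqrt x) * sqrt (sqrt x)) A"
      by (rule fun_calc_mult[OF A cont(2) cont(2)])
    \<comment> \<open>\<open>sqrt\<close> takes negative values at negative arguments, so as a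
      function on all reals the product is the absolute value. It agrees with \<open>sqrt\<close> on
      the interval, so one approximating sequence serves both.\<close>
    also have "(\<lambda>x. sqrt (sqrt x) * sqrt (sqrt x)) = (\<lambda>x. \<bar>sqrt x\<bar>)" by simp
    also have "fun_calc (\<lambda>x. \<bar>sqrt x\<bar>) A = ?R"
    proof -
      obtain p where p: "uniform_limit {0..norm A} (\<lambda>n. poly (p n)) sqrt sequentially"
        using uniform_limit_poly_exists[OF cont(1)] .
      then have "uniform_limit {0..norm A} (\<lambda>n. poly (p n)) (\<lambda>x. \<bar>sqrt x\<bar>) sequentially"
        by (rule uniform_limit_cong'[THEN iffD1, rotated 2]) auto
      from fun_calc_tendsto[OF A this] fun_calc_tendsto[OF A p] show ?thesis
        by (rule LIMSEQ_unique)
    qed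
    finally show ?thesis .
  qed
  have "positive_op ?R"
  proof (rule selfadjoint_positive_op)
    show "complex_linear ?R" "selfadjoint ?R"
      by (intro complex_linear_fun_calc selfadjoint_fun_calc A cont)+
    show "0 \<le> Re (cinner x (?R x))" for x
      using selfadjoint_norm_square[OF selfadjoint_fun_calc[OF A cont(2)], of x] QQ
      by (metis zero_le_power2)
  qed
  with RR have ex: "\<exists>!B. positive_op B \<and> B o\<^sub>L B = A"
    using positive_sqrt_unique A by metis
  from theI'[OF this] show "positive_op (sqrt_op A)" "sqrt_op A o\<^sub>L sqrt_op A = A"
    unfolding sqrt_op_def by blast+
qed

section \<open>Fractional powers of a positive operator\<close>

lemma continuous_on_powr_const:
  fixes t :: real
  assumes "t > 0"
  shows "continuous_on {0..b} (\<lambda>x. x powr t)"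
  using assms by (intro continuous_on_powr' continuous_intros) auto

lemma complex_linear_powr_op:
  assumes "positive_op A" "t \<ge> 0"
  shows "complex_linear (powr_op A t)"
  using assms by (simp add: powr_op_def complex_linear_id complex_linear_fun_calc
      continuous_on_powr_const)

lemma powr_op_one: "positive_op A \<Longrightarrow> powr_op A 1 = A"
  by (auto simp: powr_op_def intro!: fun_calc_id)

text \<open>For \<open>t\<close> strictly between 0 and 1 this is multiplicativity of the calculus;
  at the endpoints one factor is the identity by definition.\<close>

lemma powr_op_mult_complement:
  assumes A: "positive_op A" and t: "0 \<le> t" "t \<le> 1"
  shows "powr_op A (1 - t) o\<^sub>L powr_op A t = A"
proof -
  consider "t = 0" | "t = 1" | "0 < t" "t < 1" using t by linarith
  then show ?thesis
  proof cases
    case 3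
    have "powr_op A (1 - t) o\<^sub>L powr_op A t = fun_calc (\<lambda>x. x powr (1 - t) * x powr t) A"
      using 3 by (simp add: powr_op_def fun_calc_mult A continuous_on_powr_const)
    also have "\<dots> = A"
      by (rule fun_calc_id[OF A]) (simp add: powr_add[symmetric])
    finally show ?thesis .
  qed (auto simp: powr_op_one A powr_op_def[of _ 0] intro: blinfun_eqI)
qed

lemma norm_powr_op_le:
  assumes A: "positive_op A" and t: "0 < t"
  shows "norm (powr_op A t) \<le> norm A powr t"
  using t by (auto simp: powr_op_def intro!: norm_fun_calc_le A continuous_on_powr_const powr_mono2)

lemma norm_powr_op_mult_le:
  assumes A: "positive_op A" and t: "0 \<le> t" "t \<le> 1"
  shows "norm (powr_op A t) * norm (powr_op A (1 - t)) \<le> norm A"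
proof -
  consider "t = 0" | "t = 1" | "0 < t" "t < 1" using t by linarith
  then show ?thesis
  proof cases
    case 3
    then have "norm (powr_op A t) * norm (powr_op A (1 - t)) \<le> norm A powr t * norm A powr (1 - t)"
      by (intro mult_mono norm_powr_op_le A) auto
    also have "\<dots> = norm A" by (simp add: powr_add[symmetric])
    finally show ?thesis .
  \<comment> \<open>At the endpoints one factor is the identity, of norm at most 1, and the other is
    \<open>A\<close>.\<close>
  qed (use norm_blinfun_id_le in \<open>auto simp: powr_op_one A powr_op_def[of _ 0] intro: mult_left_le mult_left_le_one_le\<close>)
qed

section \<open>The spherical polar decomposition\<close>

lemma power2_norm_column:
  fixes V :: "'d::finite \<Rightarrow> 'a::chilbert_space \<Rightarrow>\<^sub>L 'a"
  shows "(norm (column V x))\<^sup>2 = (\<Sum>i\<in>UNIV. (norm (V i x))\<^sup>2)"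
  by (simp add: column_def norm_vec_def L2_set_def sum_nonneg)

lemma norm_component_le_column:
  fixes V :: "'d::finite \<Rightarrow> 'a::chilbert_space \<Rightarrow>\<^sub>L 'a"
  shows "norm (V i x) \<le> norm (column V x)"
  using Finite_Cartesian_Product.norm_nth_le[of "column V x" i] by (simp add: column_def)

text \<open>The form of the operator \<open>S\<close> under the root is the squared column norm,
  hence \<open>S\<close> is positive, and so is the squared norm of the modulus at \<open>x\<close>.
  Consequently \<open>norm2 T\<close> is the operator norm of the column.\<close>

lemma spherical_modulus:
  fixes T :: "'d::finite \<Rightarrow> 'a::chilbert_space \<Rightarrow>\<^sub>L 'a"
  assumes T: "\<And>i. complex_linear (T i)"
  shows "positive_op (spherical_modulus T)"
    and "norm (spherical_modulus T x) = norm (column T x)"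
proof -
  define S where "S = (\<Sum>i\<in>UNIV. cadjoint (T i) o\<^sub>L T i)"
  have S: "cinner x (S x) = of_real ((norm (column T x))\<^sup>2)" for x
    by (simp add: S_def blinfun.sum_left cinner_sum_right cadjoint[OF T, symmetric] cinner_self
        power2_norm_column)
  have "complex_linear S"
    unfolding S_def by (intro complex_linear_sum complex_linear_compose complex_linear_cadjoint T)
  then have "positive_op S"
    by (simp add: positive_op_def S)
  note R = sqrt_op[OF this, folded spherical_modulus_def[of T, folded S_def]]
  show pos: "positive_op (spherical_modulus T)" by (rule R)
  have "(norm (spherical_modulus T x))\<^sup>2 = (norm (column T x))\<^sup>2"
    by (simp only: selfadjoint_norm_square[OF positive_op_selfadjoint[OF pos]] R S Re_complex_of_real)
  then show "norm (spherical_modulus T x) = norm (column T x)"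
    by (simp add: power2_eq_iff_nonneg)
qed

lemma norm_column_le:
  assumes "\<And>i. complex_linear (T i)"
  shows "norm (column T x) \<le> norm2 T * norm x"
  using norm_blinfun[of "spherical_modulus T" x] by (simp add: spherical_modulus assms norm2_def)

lemma norm2_le:
  assumes "\<And>i. complex_linear (T i)" "0 \<le> c" "\<And>x. norm (column T x) \<le> c * norm x"
  shows "norm2 T \<le> c"
  unfolding norm2_def by (rule norm_blinfun_bound) (simp_all add: spherical_modulus assms)

text \<open>Here \<open>g\<^sub>n(x) = (1 - (1 - x/M)\<^sup>n) / x\<close> for some \<open>M > \<parallel>P\<parallel>\<close>, so \<open>P g\<^sub>n(P)\<close> tends strongly to the
  projection onto the closure of the range of \<open>P\<close>, and \<open>z\<close> is the component of \<open>x\<close> in the kernel.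
  The vectors \<open>(1 - P/M)\<^sup>n x\<close> form a Cauchy sequence because
  \<open>\<langle>x, (1 - P/M)\<^sup>n x\<rangle>\<close> decreases with \<open>n\<close>.\<close>

lemma range_projection_polynomials:
  fixes P :: "'a::chilbert_space \<Rightarrow>\<^sub>L 'a"
  assumes P: "positive_op P"
  obtains g :: "nat \<Rightarrow> real poly" where "\<forall>x. \<exists>z. (\<lambda>n. P (poly_op (g n) P x)) \<longlonglongrightarrow> x - z \<and> P z = 0"
proof -
  \<comment> \<open>Adding 1 makes \<open>M\<close> positive even for \<open>P = 0\<close> and puts
    \<open>1 - x / M\<close> into the unit interval for every \<open>x\<close> in
    \<open>{0..norm P}\<close>.\<close>
  define M where "M = norm P + 1"
  have M: "M > 0" by (simp add: M_def add_nonneg_pos)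
  define q :: "nat \<Rightarrow> real poly" where "q n = [:1, - (1 / M):] ^ n" for n
  define g where "g n = smult (1 / M) (\<Sum>k<n. q k)" for n
  define E where "E n = poly_op (q n) P" for n
  have qSuc: "q (Suc n) = q n - smult (1 / M) ([:0, 1:] * q n)" for n
    by (simp add: q_def)
  have qg: "[:0, 1:] * g n = 1 - q n" for n
  proof (induction n)
    case 0
    show ?case by (simp add: g_def q_def)
  next
    case (Suc n)
    have "[:0, 1:] * g (Suc n) = [:0, 1:] * g n + smult (1 / M) ([:0, 1:] * q n)"
      by (simp only: g_def sum.lessThan_Suc smult_add_right distrib_left mult_smult_right)
    also have "\<dots> = 1 - q (Suc n)"
      by (simp only: Suc qSuc diff_diff_eq2 diff_add_eq)
    finally show ?case .
  qed
  have PG: "P (poly_op (g n) P x) = x - E n x" for n x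
  proof -
    have "P (poly_op (g n) P x) = poly_op ([:0, 1:] * g n) P x"
      by (simp only: poly_op_mult poly_op_X blinfun_apply_blinfun_compose)
    also have "\<dots> = x - E n x"
      by (simp only: qg poly_op_diff one_pCons poly_op_const E_def) (simp add: blinfun.diff_left)
    finally show ?thesis .
  qed
  have sa: "cinner (E n x) y = cinner x (E n y)" for n x y
    using selfadjoint_poly_op[OF positive_op_selfadjoint[OF P]] by (simp add: E_def selfadjoint_def)
  have EE: "E m (E n x) = E (m + n) x" for m n x
    by (simp only: E_def q_def power_add poly_op_mult blinfun_apply_blinfun_compose)
  have q01: "0 \<le> poly (q n) x" "poly (q (Suc n)) x \<le> poly (q n) x" if "x \<in> {0..norm P}" for n x
  proof -
    have "0 \<le> 1 - x / M" "1 - x / M \<le> 1" using that M by (auto simp: M_def)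
    moreover have "poly (q n) x = (1 - x / M) ^ n" for n
      by (simp add: q_def poly_power)
    ultimately show "0 \<le> poly (q n) x" "poly (q (Suc n)) x \<le> poly (q n) x"
      by (simp_all only: zero_le_power power_decreasing le_SucI order_refl)
  qed
  have "\<exists>z. (\<lambda>n. P (poly_op (g n) P x)) \<longlonglongrightarrow> x - z \<and> P z = 0" for x
  proof -
    define a where "a k = Re (cinner x (E k x))" for k
    have "0 \<le> a k" for k
      unfolding a_def E_def using q01(1) by (rule poly_op_nonneg[OF P])
    moreover have "a (Suc k) \<le> a k" for k
      using poly_op_nonneg[OF P, of "q k - q (Suc k)" x] q01(2)
      by (simp add: a_def E_def poly_op_diff blinfun.diff_left cinner_diff_right)
    ultimately obtain L where L: "a \<longlonglongrightarrow> L"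
      using decseq_convergent[of a 0] decseq_SucI[of a] by metis
    \<comment> \<open>Since the \<open>E n\<close> are selfadjoint and
      \<open>E m E n = E (m + n)\<close>, squared distances involve only values of the convergent
      sequence \<open>a\<close>, and their coefficients 1, -2, 1 cancel in the limit.\<close>
    have dist: "(norm (E m x - E n x))\<^sup>2 = a (m + m) - 2 * a (m + n) + a (n + n)" for m n
      unfolding power2_norm_diff by (simp add: power2_norm_eq_cinner sa EE a_def)
    have "Cauchy (\<lambda>n. E n x)"
    proof (rule metric_CauchyI)
      fix e :: real assume e: "e > 0"
      then have "e\<^sup>2 / 4 > 0" by simp
      from LIMSEQ_D[OF L this] obtain N where N: "\<And>k. k \<ge> N \<Longrightarrow> \<bar>a k - L\<bar> < e\<^sup>2 / 4"
        by auto
      have "dist (E m x) (E n x) < e" if "m \<ge> N" "n \<ge> N" for m n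
      proof -
        have "\<bar>a (m + m) - L\<bar> < e\<^sup>2 / 4" "\<bar>a (m + n) - L\<bar> < e\<^sup>2 / 4" "\<bar>a (n + n) - L\<bar> < e\<^sup>2 / 4"
          using that by (intro N; simp)+
        then have "(norm (E m x - E n x))\<^sup>2 < e\<^sup>2"
          unfolding dist by argo
        then show ?thesis using e by (simp add: dist_norm power2_less_imp_less)
      qed
      then show "\<exists>K. \<forall>m\<ge>K. \<forall>n\<ge>K. dist (E m x) (E n x) < e" by blast
    qed
    then obtain z where z: "(\<lambda>n. E n x) \<longlonglongrightarrow> z"
      using Cauchy_convergent convergent_def by blast
    \<comment> \<open>The right-hand side is a difference of consecutive terms of a convergent
      sequence, so it tends to 0 and \<open>P z = 0\<close>.\<close>
    have "P (E n x) = M *\<^sub>R (E n x - E (Suc n) x)" for n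
    proof -
      have "E (Suc n) x = E n x - (1 / M) *\<^sub>R P (E n x)"
        by (simp only: E_def qSuc poly_op_diff poly_op_smult poly_op_mult poly_op_X
            blinfun.diff_left blinfun.scaleR_left blinfun_apply_blinfun_compose)
      then show ?thesis using M by (simp add: scaleR_diff_right)
    qed
    then have "(\<lambda>n. P (E n x)) \<longlonglongrightarrow> M *\<^sub>R (z - z)"
      by (simp only:) (intro tendsto_intros z LIMSEQ_Suc)
    moreover have "(\<lambda>n. P (E n x)) \<longlonglongrightarrow> P z" by (intro tendsto_intros z)
    ultimately have "P z = 0" using LIMSEQ_unique by fastforce
    moreover have "(\<lambda>n. P (poly_op (g n) P x)) \<longlonglongrightarrow> x - z"
      unfolding PG by (intro tendsto_intros z)
    ultimately show ?thesis by blast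
  qed
  with that show thesis by blast
qed

text \<open>\<open>V i x\<close> is the limit of \<open>T i (G n x)\<close>, where
  \<open>P (G n x)\<close> tends to the component \<open>x - z x\<close> of \<open>x\<close>
  orthogonal to the kernel of \<open>P\<close>. The limit exists because \<open>T i\<close> is
  dominated in norm by \<open>P\<close>. Contractivity is recorded along with existence since the
  norm estimates use it.\<close>

lemma spherical_polar_unique_exists:
  fixes T :: "'d::finite \<Rightarrow> 'a::chilbert_space \<Rightarrow>\<^sub>L 'a"
  assumes T: "\<And>i. complex_linear (T i)"
  defines "P \<equiv> spherical_modulus T"
  defines "polar \<equiv> \<lambda>V. (\<forall>i. complex_linear (V i)) \<and> (\<forall>i. T i = V i o\<^sub>L P) \<and>
      column_partial_isometry V \<and> {x. column V x = 0} = {x. P x = 0}"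
  shows "\<exists>V. polar V \<and> (\<forall>x. norm (column V x) \<le> norm x) \<and> (\<forall>W. polar W \<longrightarrow> W = V)"
proof -
  have pos: "positive_op P" and norm_P: "norm (P x) = norm (column T x)" for x
    unfolding P_def by (rule spherical_modulus[OF T])+
  have sa: "cinner (P x) y = cinner x (P y)" for x y
    using positive_op_selfadjoint[OF pos] by (simp add: selfadjoint_def)
  have T_le: "norm (T i x) \<le> norm (P x)" for i x
    unfolding norm_P by (rule norm_component_le_column)
  obtain g where g: "\<forall>x. \<exists>z. (\<lambda>n. P (poly_op (g n) P x)) \<longlonglongrightarrow> x - z \<and> P z = 0"
    using range_projection_polynomials[OF pos] .
  define G where "G n = poly_op (g n) P" for n
  obtain z where lim: "\<And>x. (\<lambda>n. P (G n x)) \<longlonglongrightarrow> x - z x" and Pz: "\<And>x. P (z x) = 0"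
    using g unfolding G_def by metis
  have orth: "cinner y (x - z x) = 0" if "P y = 0" for x y
  proof -
    have "(\<lambda>n. cinner y (P (G n x))) \<longlonglongrightarrow> cinner y (x - z x)" by (intro tendsto_intros lim)
    then show ?thesis using that by (simp add: sa[symmetric] LIMSEQ_const_iff)
  qed
  have pyth: "(norm x)\<^sup>2 = (norm (z x))\<^sup>2 + (norm (x - z x))\<^sup>2" for x
    using power2_norm_add[of "z x" "x - z x"] orth[OF Pz] by simp
  have "convergent (\<lambda>n. T i (G n x))" for i x
  proof -
    have "Cauchy (\<lambda>n. P (G n x))" using lim LIMSEQ_imp_Cauchy by blast
    moreover have "dist (T i (G m x)) (T i (G n x)) \<le> dist (P (G m x)) (P (G n x))" for m n
      using T_le[of i "G m x - G n x"] by (simp add: dist_norm blinfun.diff_right)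
    ultimately have "Cauchy (\<lambda>n. T i (G n x))"
      unfolding Cauchy_def by (meson order_le_less_trans)
    then show ?thesis by (rule Cauchy_convergent)
  qed
  then obtain v where v: "\<And>i x. (\<lambda>n. T i (G n x)) \<longlonglongrightarrow> v i x"
    unfolding convergent_def by metis
  \<comment> \<open>This identity is the source of boundedness, contractivity, the kernel and the
    isometry property of the column.\<close>
  have norm_v: "(\<Sum>i\<in>UNIV. (norm (v i x))\<^sup>2) = (norm (x - z x))\<^sup>2" for x
  proof -
    have "(\<lambda>n. \<Sum>i\<in>UNIV. (norm (T i (G n x)))\<^sup>2) \<longlonglongrightarrow> (\<Sum>i\<in>UNIV. (norm (v i x))\<^sup>2)"
      by (intro tendsto_intros v)
    moreover have "(\<Sum>i\<in>UNIV. (norm (T i (G n x)))\<^sup>2) = (norm (P (G n x)))\<^sup>2" for n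
      by (simp add: norm_P power2_norm_column)
    moreover have "(\<lambda>n. (norm (P (G n x)))\<^sup>2) \<longlonglongrightarrow> (norm (x - z x))\<^sup>2"
      by (intro tendsto_intros lim)
    ultimately show ?thesis using LIMSEQ_unique by fastforce
  qed
  have lin: "v i (x + y) = v i x + v i y" "v i (r *\<^sub>R x) = r *\<^sub>R v i x" "v i (c *\<^sub>C x) = c *\<^sub>C v i x"
    for i x y r c
  proof -
    have "(\<lambda>n. T i (G n x) + T i (G n y)) \<longlonglongrightarrow> v i x + v i y" by (intro tendsto_intros v)
    with v[of i "x + y"] show "v i (x + y) = v i x + v i y"
      by (simp add: blinfun.add_right LIMSEQ_unique)
    have "(\<lambda>n. r *\<^sub>R T i (G n x)) \<longlonglongrightarrow> r *\<^sub>R v i x" by (intro tendsto_intros v)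
    with v[of i "r *\<^sub>R x"] show "v i (r *\<^sub>R x) = r *\<^sub>R v i x"
      by (simp add: blinfun.scaleR_right LIMSEQ_unique)
    have "complex_linear (G n)" for n
      unfolding G_def by (rule complex_linear_poly_op) (use pos in \<open>simp add: positive_op_def\<close>)
    then have "T i (G n (c *\<^sub>C x)) = c *\<^sub>C T i (G n x)" for n
      using T by (simp add: complex_linear_def)
    moreover have "(\<lambda>n. c *\<^sub>C T i (G n x)) \<longlonglongrightarrow> c *\<^sub>C v i x" by (intro tendsto_intros v)
    ultimately show "v i (c *\<^sub>C x) = c *\<^sub>C v i x"
      using v[of i "c *\<^sub>C x"] by (simp add: LIMSEQ_unique)
  qed
  have "norm (v i x) \<le> norm x * 1" for i x
  proof -
    have "(norm (v i x))\<^sup>2 \<le> (\<Sum>i\<in>UNIV. (norm (v i x))\<^sup>2)"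
      by (rule member_le_sum) auto
    also have "\<dots> \<le> (norm x)\<^sup>2"
      using norm_v[of x] pyth[of x] by simp
    finally show ?thesis by (simp add: power2_le_iff_abs_le)
  qed
  then have bl: "bounded_linear (v i)" for i
    by (intro bounded_linear_intro[of _ 1]) (auto simp: lin)
  define V where "V i = Blinfun (v i)" for i
  have V: "V i x = v i x" for i x
    by (simp add: V_def bounded_linear_Blinfun_apply bl)
  have "(norm (column V x))\<^sup>2 = (norm (x - z x))\<^sup>2" for x
    by (simp add: power2_norm_column V norm_v)
  then have norm_V: "norm (column V x) = norm (x - z x)" for x
    by (simp add: power2_eq_iff_nonneg)
  have contr: "norm (column V x) \<le> norm x" for x
    unfolding norm_V by (rule power2_le_imp_le) (simp_all add: pyth[of x])
  have ker: "column V x = 0 \<longleftrightarrow> P x = 0" for x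
  proof
    assume "column V x = 0"
    with norm_V[of x] have "x = z x" by simp
    with Pz[of x] show "P x = 0" by simp
  next
    assume "P x = 0"
    moreover have "P (G n x) = G n (P x)" for n
      unfolding G_def by (rule poly_op_commute)
    ultimately have "x - z x = 0"
      using lim[of x] by (simp add: LIMSEQ_const_iff)
    with norm_V[of x] show "column V x = 0" by simp
  qed
  have "T i = V i o\<^sub>L P" for i
  proof (rule blinfun_eqI)
    fix x
    \<comment> \<open>\<open>z (P x)\<close> is orthogonal both to \<open>P x\<close> and to
      \<open>P x - z (P x)\<close>, hence to itself. So \<open>P x\<close> has no kernel component
      and \<open>P (G n (P x))\<close> tends to \<open>P x\<close>.\<close>
    have "cinner (z (P x)) (P x) = 0"
      by (simp add: sa[symmetric] Pz)
    then have "z (P x) = 0"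
      using orth[OF Pz, of "P x" "P x"] by (simp add: cinner_diff_right cinner_self)
    with lim[of "P x"] have conv: "(\<lambda>n. norm (P (G n (P x)) - P x)) \<longlonglongrightarrow> 0"
      by (simp add: tendsto_norm_zero_iff LIM_zero_iff)
    have "norm (T i (G n (P x)) - T i x) \<le> norm (P (G n (P x)) - P x)" for n
      using T_le[of i "G n (P x) - x"] by (simp add: blinfun.diff_right)
    then have "(\<lambda>n. T i (G n (P x)) - T i x) \<longlonglongrightarrow> 0"
      by (intro Lim_null_comparison[OF always_eventually conv] allI)
    then have "(\<lambda>n. T i (G n (P x))) \<longlonglongrightarrow> T i x"
      by (rule LIM_zero_cancel)
    with v[of i "P x"] show "T i x = (V i o\<^sub>L P) x"
      by (simp add: V LIMSEQ_unique)
  qed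
  moreover have "column_partial_isometry V"
    unfolding column_partial_isometry_def
  proof (intro allI impI)
    fix x assume "\<forall>y. column V y = 0 \<longrightarrow> cinner y x = 0"
    then have "cinner (z x) x = 0" by (simp add: ker Pz)
    then have "z x = 0"
      using orth[OF Pz, of x x] by (simp add: cinner_diff_right cinner_self)
    then show "norm (column V x) = norm x" by (simp add: norm_V)
  qed
  ultimately have "polar V"
    by (simp add: polar_def ker complex_linear_def V lin)
  \<comment> \<open>\<open>W\<close> vanishes at \<open>z x\<close> because its column has the
    kernel of \<open>P\<close>, and on \<open>P (G n x)\<close> it is prescribed by
    \<open>T\<close>; hence \<open>W i x\<close> is the limit that defines
    \<open>V i x\<close>.\<close>
  moreover have "W = V" if W: "polar W" for W
  proof (intro ext blinfun_eqI)
    fix i x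
    have TW: "T i x = W i (P x)" for i x using W by (simp add: polar_def)
    have "column W (z x) = 0" using W Pz by (auto simp: polar_def)
    then have "W i (z x) = 0"
      using norm_component_le_column[of W i "z x"] by simp
    moreover have "(\<lambda>n. W i (P (G n x))) \<longlonglongrightarrow> W i (x - z x)" by (intro tendsto_intros lim)
    ultimately show "W i x = V i x"
      using v[of i x] by (simp add: V TW blinfun.diff_right LIMSEQ_unique)
  qed
  ultimately show ?thesis using contr by blast
qed

lemma spherical_polar:
  fixes T :: "'d::finite \<Rightarrow> 'a::chilbert_space \<Rightarrow>\<^sub>L 'a"
  assumes T: "\<And>i. complex_linear (T i)"
  shows "complex_linear (spherical_polar T i)"
    and "spherical_polar T i o\<^sub>L spherical_modulus T = T i"
    and "norm (column (spherical_polar T) x) \<le> norm x"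
proof -
  define polar where "polar V \<longleftrightarrow> (\<forall>i. complex_linear (V i)) \<and>
      (\<forall>i. T i = V i o\<^sub>L spherical_modulus T) \<and> column_partial_isometry V \<and>
      {x. column V x = 0} = {x. spherical_modulus T x = 0}" for V :: "'d \<Rightarrow> 'a \<Rightarrow>\<^sub>L 'a"
  have "\<exists>V. polar V \<and> (\<forall>x. norm (column V x) \<le> norm x) \<and> (\<forall>W. polar W \<longrightarrow> W = V)"
    unfolding polar_def by (rule spherical_polar_unique_exists[OF T])
  then obtain V where V: "polar V" and contr: "\<And>x. norm (column V x) \<le> norm x"
    and unique: "\<And>W. polar W \<Longrightarrow> W = V"
    by blast
  have "spherical_polar T = V"
    unfolding spherical_polar_def polar_def[symmetric] using V unique by (rule the_equality)
  with V contr show "complex_linear (spherical_polar T i)"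
    "spherical_polar T i o\<^sub>L spherical_modulus T = T i"
    "norm (column (spherical_polar T) x) \<le> norm x"
    by (simp_all add: polar_def)
qed

section \<open>The Aluthge transform does not increase the norm\<close>

lemma complex_linear_aluthge:
  fixes T :: "'d::finite \<Rightarrow> 'a::chilbert_space \<Rightarrow>\<^sub>L 'a"
  assumes T: "\<And>i. complex_linear (T i)" and t: "0 \<le> t" "t \<le> 1"
  shows "complex_linear (aluthge t T i)"
  unfolding aluthge_def
  by (intro complex_linear_compose complex_linear_powr_op spherical_polar spherical_modulus T)
    (use t in auto)

lemma norm2_aluthge_le:
  fixes T :: "'d::finite \<Rightarrow> 'a::chilbert_space \<Rightarrow>\<^sub>L 'a"
  assumes T: "\<And>i. complex_linear (T i)" and t: "0 \<le> t" "t \<le> 1"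
  shows "norm2 (aluthge t T) \<le> norm2 T"
proof (rule norm2_le)
  define P where "P = spherical_modulus T"
  have pos: "positive_op P" unfolding P_def by (rule spherical_modulus[OF T])
  show "complex_linear (aluthge t T i)" for i by (rule complex_linear_aluthge[OF T t])
  show "0 \<le> norm2 T" by (simp add: norm2_def)
  fix x
  define y where "y = powr_op P (1 - t) x"
  have "(norm (column (aluthge t T) x))\<^sup>2 = (\<Sum>i\<in>UNIV. (norm (powr_op P t (spherical_polar T i y)))\<^sup>2)"
    by (simp add: power2_norm_column aluthge_def P_def y_def)
  also have "\<dots> \<le> (\<Sum>i\<in>UNIV. (norm (powr_op P t) * norm (spherical_polar T i y))\<^sup>2)"
    by (intro sum_mono power_mono norm_blinfun norm_ge_zero)
  also have "\<dots> = (norm (powr_op P t) * norm (column (spherical_polar T) y))\<^sup>2"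
    by (simp add: power_mult_distrib sum_distrib_left power2_norm_column)
  finally have "norm (column (aluthge t T) x) \<le> norm (powr_op P t) * norm (column (spherical_polar T) y)"
    by (rule power2_le_imp_le) simp
  also have "\<dots> \<le> norm (powr_op P t) * (norm (powr_op P (1 - t)) * norm x)"
    unfolding y_def by (intro mult_left_mono order_trans[OF spherical_polar(3)[OF T]] norm_blinfun norm_ge_zero)
  also have "\<dots> \<le> norm2 T * norm x"
    using mult_right_mono[OF norm_powr_op_mult_le[OF pos t] norm_ge_zero[of x]]
    by (simp add: norm2_def P_def mult_ac)
  finally show "norm (column (aluthge t T) x) \<le> norm2 T * norm x" .
qed

section \<open>Exactness of the Koszul complex\<close>

text \<open>Exactness is an algebraic property, so plain complex-linear functions suffice; the
  inverse entering the homotopy can then be used without proving it bounded.\<close>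

abbreviation clinear :: "('a::chilbert_space \<Rightarrow> 'a) \<Rightarrow> bool" where
  "clinear \<equiv> Vector_Spaces.linear scaleC scaleC"

lemma clinear_iff:
  "clinear f \<longleftrightarrow> (\<forall>x y. f (x + y) = f x + f y) \<and> (\<forall>c x. f (c *\<^sub>C x) = c *\<^sub>C f x)"
  using complex_vector.vector_space_axioms by (auto simp: Vector_Spaces.linear_iff)

lemma complex_linear_clinear: "complex_linear A \<Longrightarrow> clinear (blinfun_apply A)"
  by (simp add: clinear_iff complex_linear_def blinfun.add_right)

lemma
  assumes "clinear f"
  shows clinear_add: "f (x + y) = f x + f y"
    and clinear_diff: "f (x - y) = f x - f y"
    and clinear_zero: "f 0 = 0"
    and clinear_scaleC: "f (c *\<^sub>C x) = c *\<^sub>C f x"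
    and clinear_sum: "f (\<Sum>i\<in>I. g i) = (\<Sum>i\<in>I. f (g i))"
proof -
  interpret module_hom "scaleC :: complex \<Rightarrow> 'a \<Rightarrow> 'a" scaleC f
    using assms by (simp add: module_hom_iff_linear)
  show "f (x + y) = f x + f y" "f (x - y) = f x - f y" "f 0 = 0" "f (c *\<^sub>C x) = c *\<^sub>C f x"
    "f (\<Sum>i\<in>I. g i) = (\<Sum>i\<in>I. f (g i))"
    by (rule add diff zero scale sum)+
qed

section \<open>Signs of the wedge product and the Koszul differential\<close>

definition ksign :: "'d::{finite,linorder} \<Rightarrow> 'd set \<Rightarrow> complex" where
  "ksign i S = (- 1) ^ card {j \<in> S. j < i}"

lemma ksign_mult_self: "ksign i S * ksign i S = 1"
  by (simp add: ksign_def power_mult_distrib[symmetric])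

lemma ksign_insert:
  assumes "i \<notin> S"
  shows "ksign j (insert i S) = (if i < j then - ksign j S else ksign j S)"
proof (cases "i < j")
  case True
  then have "{k \<in> insert i S. k < j} = insert i {k \<in> S. k < j}" by auto
  with assms True show ?thesis by (simp add: ksign_def)
next
  case False
  then have "{k \<in> insert i S. k < j} = {k \<in> S. k < j}" by auto
  with False show ?thesis by (simp add: ksign_def)
qed

text \<open>Exactly one of \<open>i < j\<close> and \<open>j < i\<close> holds, so exactly one of
  the two insertions flips a sign. This form makes the square of the differential vanish; the next
  one cancels the mixed terms of the homotopy.\<close>

lemma ksign_swap:
  assumes "i \<noteq> j" "i \<notin> U" "j \<notin> U"
  shows "ksign i (insert j U) * ksign j U = - (ksign j (insert i U) * ksign i U)"
  using assms by (auto simp: ksign_insert)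

lemma ksign_exchange:
  assumes "i \<noteq> j" "i \<notin> U" "j \<notin> U"
  shows "ksign i U * ksign j U = - (ksign j (insert i U) * ksign i (insert j U))"
  using assms by (auto simp: ksign_insert)

text \<open>For fixed \<open>R\<close> and \<open>i\<close>, the only set \<open>S\<close> with a
  nonzero coefficient is \<open>R - {i}\<close>, and it occurs only for \<open>i\<close> in
  \<open>R\<close>.\<close>

lemma koszul_map_eq:
  "koszul_map A \<omega> R = (\<Sum>i\<in>R. ksign i (R - {i}) *\<^sub>C A i (\<omega> (R - {i})))"
proof -
  have "(\<Sum>S\<in>UNIV. wedge_coeff i S R *\<^sub>C A i (\<omega> S))
      = (if i \<in> R then ksign i (R - {i}) *\<^sub>C A i (\<omega> (R - {i})) else 0)" for i
  proof -
    have "wedge_coeff i S R *\<^sub>C A i (\<omega> S)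
        = (if S = R - {i} then (if i \<in> R then ksign i (R - {i}) *\<^sub>C A i (\<omega> (R - {i})) else 0) else 0)" for S
    proof (cases "i \<in> R \<and> S = R - {i}")
      case True
      then show ?thesis by (auto simp: wedge_coeff_def ksign_def insert_absorb)
    next
      case False
      then have "\<not> (i \<notin> S \<and> R = insert i S)" by auto
      with False show ?thesis by (auto simp: wedge_coeff_def scaleC_simps)
    qed
    then show ?thesis by (simp add: sum.delta)
  qed
  then show ?thesis
    by (simp add: koszul_map_def sum.If_cases)
qed

lemma koszul_map_zero:
  assumes "\<And>i. clinear (A i)"
  shows "koszul_map A (\<lambda>_. 0) = (\<lambda>_. 0)"
  by (simp add: fun_eq_iff koszul_map_eq clinear_zero[OF assms] scaleC_simps)

lemma koszul_map_in_space:
  assumes A: "\<And>i. clinear (A i)" and \<omega>: "\<omega> \<in> koszul_space k"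
  shows "koszul_map A \<omega> \<in> koszul_space (Suc k)"
  unfolding koszul_space_def
proof (intro CollectI allI impI)
  fix R :: "'a set" assume R: "card R \<noteq> Suc k"
  have "\<omega> (R - {i}) = 0" if "i \<in> R" for i
    using \<omega> R card.remove[OF finite that] by (simp add: koszul_space_def)
  then show "koszul_map A \<omega> R = 0"
    by (simp add: koszul_map_eq clinear_zero[OF A] scaleC_simps)
qed

text \<open>The sum equals its own negative after exchanging the indices. Extending \<open>F\<close>
  by zero to the diagonal makes the index set a full square, where the order of summation can be
  swapped.\<close>

lemma sum_antisymmetric_eq_zero:
  fixes F :: "'i \<Rightarrow> 'i \<Rightarrow> 'b::real_vector"
  assumes R: "finite R" and F: "\<And>i j. i \<in> R \<Longrightarrow> j \<in> R \<Longrightarrow> i \<noteq> j \<Longrightarrow> F i j = - F j i"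
  shows "(\<Sum>i\<in>R. \<Sum>j\<in>R - {i}. F i j) = 0"
proof -
  define G where "G i j = (if i = j then 0 else F i j)" for i j
  have G: "G i j = - G j i" if "i \<in> R" "j \<in> R" for i j
    using F[OF that] by (cases "i = j") (simp_all add: G_def)
  have "(\<Sum>j\<in>R - {i}. F i j) = (\<Sum>j\<in>R. G i j)" for i
    by (rule sum.mono_neutral_cong_left) (use R in \<open>auto simp: G_def\<close>)
  then have eq: "(\<Sum>i\<in>R. \<Sum>j\<in>R - {i}. F i j) = (\<Sum>i\<in>R. \<Sum>j\<in>R. G i j)" by simp
  also have "\<dots> = (\<Sum>j\<in>R. \<Sum>i\<in>R. G i j)" by (rule sum.swap)
  also have "\<dots> = (\<Sum>j\<in>R. \<Sum>i\<in>R. - G j i)" by (intro sum.cong refl G)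
  also have "\<dots> = - (\<Sum>i\<in>R. \<Sum>j\<in>R - {i}. F i j)" by (simp add: eq sum_negf)
  finally have "2 *\<^sub>R (\<Sum>i\<in>R. \<Sum>j\<in>R - {i}. F i j) = 0"
    by (simp only: scaleR_2 eq_neg_iff_add_eq_0)
  then show ?thesis by simp
qed

lemma koszul_map_koszul_map:
  assumes A: "\<And>i. clinear (A i)" and comm: "\<And>i j x. A i (A j x) = A j (A i x)"
  shows "koszul_map A (koszul_map A \<omega>) = (\<lambda>_. 0)"
proof
  fix R :: "'a set"
  define F where "F i j = (ksign i (R - {i}) * ksign j (R - {i} - {j})) *\<^sub>C A i (A j (\<omega> (R - {i} - {j})))"
    for i j
  have "koszul_map A (koszul_map A \<omega>) R = (\<Sum>i\<in>R. \<Sum>j\<in>R - {i}. F i j)"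
    by (simp add: koszul_map_eq clinear_sum[OF A] clinear_scaleC[OF A] scaleC_sum_right scaleC_scaleC
        F_def)
  also have "\<dots> = 0"
  proof (rule sum_antisymmetric_eq_zero)
    fix i j assume ij: "i \<in> R" "j \<in> R" "i \<noteq> j"
    define U where "U = R - {i} - {j}"
    have U: "R - {i} = insert j U" "R - {j} = insert i U" "insert i U - {i} = U" "insert j U - {j} = U"
      using ij by (auto simp: U_def)
    have "F i j = (ksign i (insert j U) * ksign j U) *\<^sub>C A i (A j (\<omega> U))"
      unfolding F_def U ..
    also have "\<dots> = - ((ksign j (insert i U) * ksign i U) *\<^sub>C A j (A i (\<omega> U)))"
      by (subst ksign_swap) (use ij in \<open>auto simp: U_def scaleC_simps comm\<close>)
    also have "\<dots> = - F j i"
      unfolding F_def U ..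
    finally show "F i j = - F j i" .
  qed simp
  finally show "koszul_map A (koszul_map A \<omega>) R = 0" .
qed

text \<open>Contraction against \<open>B\<close>; it is a contracting homotopy of the Koszul complex of \<open>A\<close> as soon as
  \<open>\<Sum>\<^sub>i B\<^sub>i A\<^sub>i = I\<close>.\<close>

definition koszul_homotopy ::
    "('d::{finite,linorder} \<Rightarrow> 'a \<Rightarrow> 'a) \<Rightarrow> ('d set \<Rightarrow> 'a::chilbert_space) \<Rightarrow> 'd set \<Rightarrow> 'a" where
  "koszul_homotopy B \<omega> S = (\<Sum>j\<in>- S. ksign j S *\<^sub>C B j (\<omega> (insert j S)))"

text \<open>One composition contributes the diagonal terms \<open>B i (A i (\<omega> R))\<close>
  with \<open>i\<close> in \<open>R\<close>, the other those with \<open>i\<close> outside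
  \<open>R\<close>; together they give the identity. The remaining terms \<open>F i j\<close>, which
  remove \<open>i\<close> from \<open>R\<close> and add \<open>j\<close>, occur with opposite signs
  by \<open>ksign_exchange\<close>.\<close>

lemma koszul_homotopy_identity:
  fixes A B :: "'d::{finite,linorder} \<Rightarrow> 'a \<Rightarrow> 'a::chilbert_space"
  assumes A: "\<And>i. clinear (A i)" and B: "\<And>i. clinear (B i)"
    and BA: "\<And>i j x. B i (A j x) = A j (B i x)"
    and one: "\<And>x. (\<Sum>i\<in>UNIV. B i (A i x)) = x"
  shows "koszul_map A (koszul_homotopy B \<omega>) R + koszul_homotopy B (koszul_map A \<omega>) R = \<omega> R"
proof -
  define F where "F i j = (ksign i (R - {i}) * ksign j (R - {i})) *\<^sub>C B j (A i (\<omega> (insert j (R - {i}))))"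
    for i j
  \<comment> \<open>The index \<open>i\<close> lies outside \<open>R - {i}\<close> and may be put
    back; this gives the diagonal term.\<close>
  have inner: "(\<Sum>j\<in>- (R - {i}). ksign j (R - {i}) *\<^sub>C B j (\<omega> (insert j (R - {i}))))
      = ksign i (R - {i}) *\<^sub>C B i (\<omega> R) + (\<Sum>j\<in>- R. ksign j (R - {i}) *\<^sub>C B j (\<omega> (insert j (R - {i}))))"
    if "i \<in> R" for i
  proof -
    have "- (R - {i}) = insert i (- R)" "insert i (R - {i}) = R" using that by auto
    then show ?thesis using that by simp
  qed
  have "koszul_map A (koszul_homotopy B \<omega>) R
      = (\<Sum>i\<in>R. ksign i (R - {i}) *\<^sub>C A i (ksign i (R - {i}) *\<^sub>C B i (\<omega> R)
          + (\<Sum>j\<in>- R. ksign j (R - {i}) *\<^sub>C B j (\<omega> (insert j (R - {i}))))))"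
    unfolding koszul_map_eq koszul_homotopy_def by (intro sum.cong refl) (simp only: inner)
  also have "\<dots> = (\<Sum>i\<in>R. B i (A i (\<omega> R)) + (\<Sum>j\<in>- R. F i j))"
    by (simp add: clinear_add[OF A] clinear_sum[OF A] clinear_scaleC[OF A] scaleC_add_right
        scaleC_sum_right scaleC_scaleC ksign_mult_self scaleC_simps BA F_def)
  finally have dh: "koszul_map A (koszul_homotopy B \<omega>) R
      = (\<Sum>i\<in>R. B i (A i (\<omega> R))) + (\<Sum>i\<in>R. \<Sum>j\<in>- R. F i j)"
    by (simp add: sum.distrib)
  have inner': "(\<Sum>i\<in>insert j R. ksign i (insert j R - {i}) *\<^sub>C A i (\<omega> (insert j R - {i})))
      = ksign j R *\<^sub>C A j (\<omega> R)
        + (\<Sum>i\<in>R. ksign i (insert j (R - {i})) *\<^sub>C A i (\<omega> (insert j (R - {i}))))"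
    if "j \<in> - R" for j
  proof -
    have "insert j R - {i} = insert j (R - {i})" if "i \<in> R" for i using that \<open>j \<in> - R\<close> by auto
    then have "(\<Sum>i\<in>R. ksign i (insert j R - {i}) *\<^sub>C A i (\<omega> (insert j R - {i})))
        = (\<Sum>i\<in>R. ksign i (insert j (R - {i})) *\<^sub>C A i (\<omega> (insert j (R - {i}))))"
      by (intro sum.cong) simp_all
    moreover have "insert j R - {j} = R" using that by auto
    moreover have "sum h (insert j R) = h j + sum h R" for h :: "'d \<Rightarrow> 'a"
      using that by simp
    ultimately show ?thesis by (simp only:)
  qed
  have "koszul_homotopy B (koszul_map A \<omega>) R
      = (\<Sum>j\<in>- R. ksign j R *\<^sub>C B j (ksign j R *\<^sub>C A j (\<omega> R)
          + (\<Sum>i\<in>R. ksign i (insert j (R - {i})) *\<^sub>C A i (\<omega> (insert j (R - {i}))))))"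
    unfolding koszul_map_eq koszul_homotopy_def by (intro sum.cong refl) (simp only: inner')
  also have "\<dots> = (\<Sum>j\<in>- R. B j (A j (\<omega> R)) + (\<Sum>i\<in>R. - F i j))"
  proof (intro sum.cong refl)
    fix j assume j: "j \<in> - R"
    have "(ksign j R * ksign i (insert j (R - {i}))) *\<^sub>C B j (A i (\<omega> (insert j (R - {i})))) = - F i j"
      if i: "i \<in> R" for i
    proof -
      have "R = insert i (R - {i})" using i by auto
      with ksign_exchange[of i j "R - {i}"] i j
      have "ksign j R * ksign i (insert j (R - {i})) = - (ksign i (R - {i}) * ksign j (R - {i}))"
        by (metis ComplD DiffD1 Diff_iff insertI1 minus_minus)
      then show ?thesis by (simp only: F_def scaleC_simps)
    qed
    then show "ksign j R *\<^sub>C B j (ksign j R *\<^sub>C A j (\<omega> R)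
          + (\<Sum>i\<in>R. ksign i (insert j (R - {i})) *\<^sub>C A i (\<omega> (insert j (R - {i})))))
        = B j (A j (\<omega> R)) + (\<Sum>i\<in>R. - F i j)"
      by (simp add: clinear_add[OF B] clinear_sum[OF B] clinear_scaleC[OF B] scaleC_add_right
          scaleC_sum_right scaleC_scaleC ksign_mult_self scaleC_simps)
  qed
  finally have hd: "koszul_homotopy B (koszul_map A \<omega>) R
      = (\<Sum>j\<in>- R. B j (A j (\<omega> R))) - (\<Sum>j\<in>- R. \<Sum>i\<in>R. F i j)"
    by (simp add: sum.distrib sum_negf sum_subtractf)
  have "(\<Sum>i\<in>R. B i (A i (\<omega> R))) + (\<Sum>i\<in>- R. B i (A i (\<omega> R))) = \<omega> R"
    using one[of "\<omega> R"] by (subst sum.union_disjoint[symmetric]) auto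
  moreover have "(\<Sum>j\<in>- R. \<Sum>i\<in>R. F i j) = (\<Sum>i\<in>R. \<Sum>j\<in>- R. F i j)"
    by (rule sum.swap)
  ultimately show ?thesis
    unfolding dh hd by (simp add: algebra_simps)
qed

text \<open>By the homotopy identity every cycle is the boundary of its homotopy image.\<close>

lemma koszul_exactI:
  fixes A B :: "'d::{finite,linorder} \<Rightarrow> 'a \<Rightarrow> 'a::chilbert_space"
  assumes A: "\<And>i. clinear (A i)" and B: "\<And>i. clinear (B i)"
    and AA: "\<And>i j x. A i (A j x) = A j (A i x)" and BA: "\<And>i j x. B i (A j x) = A j (B i x)"
    and one: "\<And>x. (\<Sum>i\<in>UNIV. B i (A i x)) = x"
  shows "koszul_exact A"
  unfolding koszul_exact_def
proof
  fix k
  have hom: "koszul_map A (koszul_homotopy B \<omega>) = \<omega>" if "koszul_map A \<omega> = (\<lambda>_. 0)" for \<omega>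
  proof
    fix R
    show "koszul_map A (koszul_homotopy B \<omega>) R = \<omega> R"
      using koszul_homotopy_identity[OF A B BA one, of \<omega> R]
      by (simp add: that koszul_homotopy_def clinear_zero[OF B] scaleC_simps)
  qed
  show "{\<omega> \<in> koszul_space k. koszul_map A \<omega> = (\<lambda>_. 0)} =
      (if k = 0 then {\<lambda>_. 0} else koszul_map A ` koszul_space (k - 1))"
  proof (cases k)
    case 0
    have "\<omega> = (\<lambda>_. 0)" if "\<omega> \<in> koszul_space 0" "koszul_map A \<omega> = (\<lambda>_. 0)" for \<omega>
    proof -
      \<comment> \<open>In degree 0 only the empty set carries a coefficient, and
        \<open>insert j S\<close> is never empty.\<close>
      have "koszul_homotopy B \<omega> = (\<lambda>_. 0)"
        using that(1) by (simp add: fun_eq_iff koszul_homotopy_def koszul_space_def clinear_zero[OF B]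
            scaleC_simps card_insert_if)
      with hom[OF that(2)] show ?thesis by (simp add: koszul_map_zero[OF A])
    qed
    moreover have "(\<lambda>_. 0) \<in> koszul_space 0" by (simp add: koszul_space_def)
    ultimately show ?thesis
      using 0 koszul_map_zero[OF A] by auto
  next
    case (Suc m)
    have "\<omega> \<in> koszul_map A ` koszul_space m"
      if "\<omega> \<in> koszul_space k" "koszul_map A \<omega> = (\<lambda>_. 0)" for \<omega>
    proof (rule image_eqI)
      show "\<omega> = koszul_map A (koszul_homotopy B \<omega>)" using hom[OF that(2)] by simp
      show "koszul_homotopy B \<omega> \<in> koszul_space m"
        using that(1) Suc by (simp add: koszul_homotopy_def koszul_space_def clinear_zero[OF B]
            scaleC_simps card_insert_if)
    qed
    then show ?thesis
      using Suc koszul_map_in_space[OF A] koszul_map_koszul_map[OF A AA] by auto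
  qed
qed

section \<open>The spectral bound\<close>

lemma not_in_taylor_spectrum:
  fixes T :: "'d::{finite,linorder} \<Rightarrow> 'a::chilbert_space \<Rightarrow>\<^sub>L 'a"
  assumes T: "\<And>i. complex_linear (T i)" and comm: "\<And>i j. T i o\<^sub>L T j = T j o\<^sub>L T i"
    and bij: "bij (\<lambda>x. (norm l)\<^sup>2 *\<^sub>R x - (\<Sum>i\<in>UNIV. cnj (l $ i) *\<^sub>C T i x))"
  shows "l \<notin> taylor_spectrum T"
proof -
  note lin = complex_linear_clinear[OF T]
  have TT: "T i (T j x) = T j (T i x)" for i j x
    using arg_cong[OF comm[of i j], of "\<lambda>S. blinfun_apply S x"]
    by (simp only: blinfun_apply_blinfun_compose)
  define K where "K x = (norm l)\<^sup>2 *\<^sub>R x - (\<Sum>i\<in>UNIV. cnj (l $ i) *\<^sub>C T i x)" for x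
  define N where "N = inv K"
  have "bij K" using bij by (simp add: K_def[abs_def])
  then have NK: "N (K x) = x" and KN: "K (N x) = x" for x
    by (simp_all add: N_def bij_is_inj bij_is_surj surj_f_inv_f)
  have K_add: "K (x + y) = K x + K y" and K_scale: "K (c *\<^sub>C x) = c *\<^sub>C K x"
    and KT: "K (T j x) = T j (K x)" for x y c j
    by (simp_all add: K_def clinear_add[OF lin] clinear_scaleC[OF lin] clinear_diff[OF lin]
        clinear_sum[OF lin] scaleR_add_right scaleC_add_right sum.distrib scaleC_simps scaleC_scaleR
        scaleC_sum_right scaleC_scaleC mult.commute TT blinfun.scaleR_right)
  \<comment> \<open>Linearity of the inverse, like its commutation with the tuple below, is
    inherited from \<open>K\<close> by applying \<open>N\<close> on both sides.\<close>
  have N: "clinear N"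
    unfolding clinear_iff by (metis NK KN K_add K_scale)
  have NT: "N (T j x) = T j (N x)" for j x
    by (metis NK KN KT)
  define A where "A i x = T i x - (l $ i) *\<^sub>C x" for i x
  \<comment> \<open>The weights are chosen so that summing
    \<open>(- cnj (l $ i)) *\<^sub>C A i x\<close> gives \<open>K x\<close>, which \<open>N\<close>
    takes back to \<open>x\<close>.\<close>
  define B where "B i x = (- cnj (l $ i)) *\<^sub>C N x" for i x
  have "koszul_exact A"
  proof (rule koszul_exactI)
    show "clinear (A i)" for i
      by (simp add: clinear_iff A_def clinear_add[OF lin] clinear_scaleC[OF lin] scaleC_simps
          scaleC_add_right scaleC_scaleC mult.commute)
    show "clinear (B i)" for i
      by (simp add: clinear_iff B_def clinear_add[OF N] clinear_scaleC[OF N] scaleC_simps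
          scaleC_add_right scaleC_scaleC mult.commute)
    show "A i (A j x) = A j (A i x)" for i j x
      by (simp add: A_def clinear_diff[OF lin] clinear_scaleC[OF lin] scaleC_simps TT scaleC_scaleC
          mult.commute)
    show "B i (A j x) = A j (B i x)" for i j x
      by (simp add: A_def B_def clinear_diff[OF N] clinear_scaleC[OF N] clinear_scaleC[OF lin]
          scaleC_simps NT scaleC_scaleC mult.commute blinfun.minus_right)
    fix x :: 'a
    have "complex_of_real ((norm l)\<^sup>2) = (\<Sum>i\<in>UNIV. complex_of_real ((norm (l $ i))\<^sup>2))"
      by (simp add: norm_vec_def L2_set_def sum_nonneg)
    then have "(\<Sum>i\<in>UNIV. cnj (l $ i) * l $ i) = complex_of_real ((norm l)\<^sup>2)"
      by (simp only: complex_norm_square mult.commute)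
    then have "(\<Sum>i\<in>UNIV. (cnj (l $ i) * l $ i) *\<^sub>C x) = (norm l)\<^sup>2 *\<^sub>R x"
      by (simp only: complex_vector.scale_sum_left[symmetric] scaleC_of_real)
    then have "(\<Sum>i\<in>UNIV. (- cnj (l $ i)) *\<^sub>C A i x) = K x"
      by (simp add: A_def K_def scaleC_simps scaleC_scaleC sum_subtractf sum_negf)
    then have "N (\<Sum>i\<in>UNIV. (- cnj (l $ i)) *\<^sub>C A i x) = x" by (simp add: NK)
    then show "(\<Sum>i\<in>UNIV. B i (A i x)) = x"
      by (simp only: B_def clinear_sum[OF N] clinear_scaleC[OF N])
  qed
  then show ?thesis
    by (simp add: taylor_spectrum_def A_def[abs_def])
qed

text \<open>Purely algebraic: with \<open>N\<close> the inverse of \<open>m - B A\<close>, the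
  inverse of \<open>m - A B\<close> is \<open>(1 + A N B) / m\<close>.\<close>

lemma bij_minus_compose_commute:
  fixes A B :: "'a::real_vector \<Rightarrow> 'a"
  assumes A: "linear A" and B: "linear B" and m: "m \<noteq> 0"
    and bij: "bij (\<lambda>x. m *\<^sub>R x - B (A x))"
  shows "bij (\<lambda>x. m *\<^sub>R x - A (B x))"
proof (rule bijI)
  note lin = linear_add[OF A] linear_add[OF B] linear_diff[OF A] linear_diff[OF B]
    linear_scale[OF A] linear_scale[OF B]
  show "inj (\<lambda>x. m *\<^sub>R x - A (B x))"
  proof (rule injI)
    fix x y assume eq: "m *\<^sub>R x - A (B x) = m *\<^sub>R y - A (B y)"
    then have "B (m *\<^sub>R x - A (B x)) = B (m *\<^sub>R y - A (B y))" by simp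
    then have "m *\<^sub>R B x - B (A (B x)) = m *\<^sub>R B y - B (A (B y))" by (simp add: lin)
    \<comment> \<open>Applying \<open>B\<close> has turned \<open>m - A B\<close> into
      \<open>m - B A\<close>, which is injective.\<close>
    then have "B x = B y" by (rule injD[OF bij_is_inj[OF bij]])
    with eq m show "x = y" by simp
  qed
  show "surj (\<lambda>x. m *\<^sub>R x - A (B x))"
  proof (rule surjI)
    fix y
    \<comment> \<open>The preimage of \<open>y\<close> is \<open>(y + A z) / m\<close>, following
      the formula for the inverse.\<close>
    define z where "z = inv (\<lambda>x. m *\<^sub>R x - B (A x)) (B y)"
    have "m *\<^sub>R z - B (A z) = B y"
      unfolding z_def by (rule surj_f_inv_f[OF bij_is_surj[OF bij]])
    then have "m *\<^sub>R z = B (y + A z)" by (simp add: lin algebra_simps)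
    then have "A (B (y + A z)) = m *\<^sub>R A z" by (metis lin(5))
    then show "m *\<^sub>R ((1 / m) *\<^sub>R (y + A (inv (\<lambda>x. m *\<^sub>R x - B (A x)) (B y))))
        - A (B ((1 / m) *\<^sub>R (y + A (inv (\<lambda>x. m *\<^sub>R x - B (A x)) (B y))))) = y"
      unfolding z_def[symmetric] using m by (simp only: lin) simp
  qed
qed

text \<open>Solving \<open>m *\<^sub>R x - R x = y\<close> means finding a fixed point of
  \<open>x \<mapsto> (1 / m) *\<^sub>R (y + R x)\<close>, a contraction with constant
  \<open>c / m\<close>.\<close>

lemma bij_minus_contraction:
  fixes R :: "'a::banach \<Rightarrow> 'a"
  assumes R: "linear R" and bound: "\<And>x. norm (R x) \<le> c * norm x" and c: "0 \<le> c" "c < m"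
  shows "bij (\<lambda>x. m *\<^sub>R x - R x)"
proof -
  have m: "m > 0" using c by simp
  have "\<exists>!x. m *\<^sub>R x - R x = y" for y
  proof -
    have "\<exists>!x. (1 / m) *\<^sub>R (y + R x) = x"
    proof (rule banach_fix_type)
      show "0 \<le> c / m" "c / m < 1" using c m by simp_all
      show "\<forall>u v. dist ((1 / m) *\<^sub>R (y + R u)) ((1 / m) *\<^sub>R (y + R v)) \<le> c / m * dist u v"
      proof (intro allI)
        fix u v
        have "(1 / m) *\<^sub>R (y + R u) - (1 / m) *\<^sub>R (y + R v) = (1 / m) *\<^sub>R R (u - v)"
          by (simp add: linear_diff[OF R] scaleR_diff_right[symmetric])
        then show "dist ((1 / m) *\<^sub>R (y + R u)) ((1 / m) *\<^sub>R (y + R v)) \<le> c / m * dist u v"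
          using bound[of "u - v"] m by (simp add: dist_norm divide_right_mono)
      qed
    qed
    moreover have "(1 / m) *\<^sub>R (y + R x) = x \<longleftrightarrow> m *\<^sub>R x - R x = y" for x
    proof -
      have "(1 / m) *\<^sub>R (y + R x) = x \<longleftrightarrow> y + R x = m *\<^sub>R x"
        using m by (metis divide_self_if less_irrefl mult.commute scaleR_one scaleR_scaleR
            times_divide_eq_right mult_1_right)
      then show ?thesis by (auto simp: algebra_simps)
    qed
    ultimately show ?thesis by simp
  qed
  then show ?thesis by (simp add: bij_iff)
qed

section \<open>Linear combinations of the tuple and their transfer through the transform\<close>

lemma linear_pairing:
  fixes T :: "'d::finite \<Rightarrow> 'a::chilbert_space \<Rightarrow>\<^sub>L 'a"
  shows "linear (\<lambda>x. \<Sum>i\<in>UNIV. c i *\<^sub>C T i x)"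
  by (rule linearI) (simp_all add: blinfun.add_right blinfun.scaleR_right scaleC_add_right
      scaleC_scaleR sum.distrib scaleR_sum_right)

lemma norm_pairing_le:
  fixes T :: "'d::finite \<Rightarrow> 'a::chilbert_space \<Rightarrow>\<^sub>L 'a"
  assumes T: "\<And>i. complex_linear (T i)"
  shows "norm (\<Sum>i\<in>UNIV. cnj (l $ i) *\<^sub>C T i x) \<le> norm l * norm2 T * norm x"
proof -
  have "norm (\<Sum>i\<in>UNIV. cnj (l $ i) *\<^sub>C T i x) \<le> (\<Sum>i\<in>UNIV. \<bar>norm (l $ i)\<bar> * \<bar>norm (T i x)\<bar>)"
    by (rule order_trans[OF norm_sum]) (simp add: norm_scaleC)
  also have "\<dots> \<le> norm l * norm (column T x)"
    unfolding norm_vec_def column_def vec_lambda_beta by (rule L2_set_mult_ineq)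
  also have "\<dots> \<le> norm l * (norm2 T * norm x)"
    by (intro mult_left_mono norm_column_le T norm_ge_zero)
  finally show ?thesis by (simp add: mult.assoc)
qed

lemma bij_pairing_aluthge:
  fixes T :: "'d::finite \<Rightarrow> 'a::chilbert_space \<Rightarrow>\<^sub>L 'a"
  assumes T: "\<And>i. complex_linear (T i)" and t: "0 \<le> t" "t \<le> 1" and m: "m \<noteq> 0"
    and bij: "bij (\<lambda>x. m *\<^sub>R x - (\<Sum>i\<in>UNIV. c i *\<^sub>C aluthge t T i x))"
  shows "bij (\<lambda>x. m *\<^sub>R x - (\<Sum>i\<in>UNIV. c i *\<^sub>C T i x))"
proof -
  define P where "P = spherical_modulus T"
  have pos: "positive_op P" unfolding P_def by (rule spherical_modulus[OF T])
  \<comment> \<open>The factors are split so that \<open>B (A x)\<close> belongs to the transformed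
    tuple and \<open>A (B x)\<close> to the original one.\<close>
  define A where "A x = (\<Sum>i\<in>UNIV. c i *\<^sub>C (spherical_polar T i o\<^sub>L powr_op P (1 - t)) x)" for x
  define B where "B = blinfun_apply (powr_op P t)"
  have "complex_linear (powr_op P t)" by (rule complex_linear_powr_op[OF pos t(1)])
  from complex_linear_clinear[OF this] have "B (A x) = (\<Sum>i\<in>UNIV. c i *\<^sub>C aluthge t T i x)" for x
    by (simp add: A_def B_def aluthge_def P_def clinear_sum clinear_scaleC)
  moreover have "A (B x) = (\<Sum>i\<in>UNIV. c i *\<^sub>C T i x)" for x
  proof -
    have "powr_op P (1 - t) (powr_op P t x) = P x"
      using arg_cong[OF powr_op_mult_complement[OF pos t], of "\<lambda>S. blinfun_apply S x"]
      by (simp only: blinfun_apply_blinfun_compose)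
    moreover have "spherical_polar T i (P x) = T i x" for i
      using arg_cong[OF spherical_polar(2)[OF T], of "\<lambda>S. blinfun_apply S x"]
      by (simp only: P_def blinfun_apply_blinfun_compose)
    ultimately show ?thesis by (simp add: A_def B_def)
  qed
  moreover have "linear A" "linear B"
    unfolding A_def B_def by (rule linear_pairing) (rule bounded_linear.linear[OF blinfun.bounded_linear_right])
  ultimately show ?thesis
    using bij_minus_compose_commute[of A B m] m bij by simp
qed

lemma complex_linear_aluthge_iterate:
  fixes T :: "'d::finite \<Rightarrow> 'a::chilbert_space \<Rightarrow>\<^sub>L 'a"
  assumes "\<And>i. complex_linear (T i)" "0 \<le> t" "t \<le> 1"
  shows "complex_linear ((aluthge t ^^ n) T i)"
  using assms by (induction n arbitrary: i) (simp_all add: complex_linear_aluthge)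

lemma bij_pairing_aluthge_iterate:
  fixes T :: "'d::finite \<Rightarrow> 'a::chilbert_space \<Rightarrow>\<^sub>L 'a"
  assumes T: "\<And>i. complex_linear (T i)" and t: "0 \<le> t" "t \<le> 1" and m: "m \<noteq> 0"
    and bij: "bij (\<lambda>x. m *\<^sub>R x - (\<Sum>i\<in>UNIV. c i *\<^sub>C (aluthge t ^^ n) T i x))"
  shows "bij (\<lambda>x. m *\<^sub>R x - (\<Sum>i\<in>UNIV. c i *\<^sub>C T i x))"
  using bij
proof (induction n)
  case (Suc n)
  from Suc.prems have "bij (\<lambda>x. m *\<^sub>R x - (\<Sum>i\<in>UNIV. c i *\<^sub>C (aluthge t ^^ n) T i x))"
    by (intro bij_pairing_aluthge[OF complex_linear_aluthge_iterate[OF T t] t m]) simp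
  then show ?case by (rule Suc.IH)
qed simp

lemma norm2_aluthge_iterate_antimono:
  fixes T :: "'d::finite \<Rightarrow> 'a::chilbert_space \<Rightarrow>\<^sub>L 'a"
  assumes T: "\<And>i. complex_linear (T i)" and t: "0 \<le> t" "t \<le> 1"
  shows "antimono (\<lambda>n. norm2 ((aluthge t ^^ n) T))"
  by (rule decseq_SucI) (simp add: norm2_aluthge_le[OF complex_linear_aluthge_iterate[OF T t] t])

lemma joint_spectral_radius_le:
  fixes T :: "'d::{finite,linorder} \<Rightarrow> 'a::chilbert_space \<Rightarrow>\<^sub>L 'a"
  assumes T: "\<And>i. complex_linear (T i)" and comm: "\<And>i j. T i o\<^sub>L T j = T j o\<^sub>L T i"
    and t: "0 \<le> t" "t \<le> 1"
  shows "joint_spectral_radius T \<le> ereal (norm2 ((aluthge t ^^ n) T))"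
  unfolding joint_spectral_radius_def
proof (rule SUP_least)
  fix l assume l: "l \<in> taylor_spectrum T"
  define U where "U = (aluthge t ^^ n) T"
  have U: "complex_linear (U i)" for i
    unfolding U_def by (rule complex_linear_aluthge_iterate[OF T t])
  show "ereal (norm l) \<le> ereal (norm2 ((aluthge t ^^ n) T))"
  proof (rule ccontr)
    assume "\<not> ?thesis"
    then have lt: "norm2 U < norm l" by (simp add: U_def)
    moreover have nonneg: "0 \<le> norm2 U" by (simp add: norm2_def)
    \<comment> \<open>Strict positivity makes the scalar \<open>(norm l)\<^sup>2\<close> nonzero, as
      the exchange of factors requires.\<close>
    ultimately have l0: "0 < norm l" by linarith
    have "bij (\<lambda>x. (norm l)\<^sup>2 *\<^sub>R x - (\<Sum>i\<in>UNIV. cnj (l $ i) *\<^sub>C U i x))"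
    proof (rule bij_minus_contraction)
      show "norm (\<Sum>i\<in>UNIV. cnj (l $ i) *\<^sub>C U i x) \<le> (norm l * norm2 U) * norm x" for x
        by (rule norm_pairing_le[OF U])
      show "0 \<le> norm l * norm2 U" using nonneg by simp
      show "norm l * norm2 U < (norm l)\<^sup>2" using lt l0 by (simp add: power2_eq_square)
    qed (rule linear_pairing)
    moreover have "(norm l)\<^sup>2 \<noteq> 0" using l0 by simp
    ultimately have "bij (\<lambda>x. (norm l)\<^sup>2 *\<^sub>R x - (\<Sum>i\<in>UNIV. cnj (l $ i) *\<^sub>C T i x))"
      unfolding U_def by (intro bij_pairing_aluthge_iterate[OF T t])
    with l not_in_taylor_spectrum[of T l, OF T comm] show False by blast
  qed
qed

theorem theorem1p7:
  fixes T :: "'d::{finite,linorder} \<Rightarrow> 'a::chilbert_space \<Rightarrow>\<^sub>L 'a"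
    and t :: real and n :: nat
  assumes infinite_dim: "\<not> (\<exists>B :: 'a set. finite B \<and> cspan B = UNIV)"
    and operators: "\<And>i. complex_linear (T i)"
    and commuting: "\<And>i j. T i o\<^sub>L T j = T j o\<^sub>L T i"
    and t: "0 \<le> t" "t \<le> 1"
    and n: "n \<ge> 1"
  shows "joint_spectral_radius T \<le> ereal (norm2 ((aluthge t ^^ (n + 1)) T)) \<and>
         norm2 ((aluthge t ^^ (n + 1)) T) \<le> norm2 ((aluthge t ^^ n) T) \<and>
         norm2 ((aluthge t ^^ n) T) \<le> norm2 T"
proof (intro conjI)
  note antimono = norm2_aluthge_iterate_antimono[OF operators t]
  show "joint_spectral_radius T \<le> ereal (norm2 ((aluthge t ^^ (n + 1)) T))"
    by (rule joint_spectral_radius_le[OF operators commuting t])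
  show "norm2 ((aluthge t ^^ (n + 1)) T) \<le> norm2 ((aluthge t ^^ n) T)"
    by (rule antimonoD[OF antimono]) simp
  show "norm2 ((aluthge t ^^ n) T) \<le> norm2 T"
    using antimonoD[OF antimono, of 0 n] by simp
qed

end
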